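(* Let $\tilde\delta_n$ be a sequence of random elements of $\mathbb{R}^p$ and let $q_n$ be a sequence of (almost surely twice continuously differentiable) log likelihoods having parameter space $\mathbb{R}^p$ and true parameter value zero. Suppose $$(q_n,\tilde\delta_n)\stackrel{\mathcal{L}}{\longrightarrow}(q,\tilde\delta)\qquad\text{in } C^2(\mathbb{R}^p)\times\mathbb{R}^p,$$ where $q$ is the log likelihood of an LAMN model, $q(\delta)=\delta'Z-\tfrac12\delta'K\delta$, $\delta\in\mathbb{R}^p$, with true parameter value zero, and suppose that $K=-\nabla^2q(\delta)$ is a constant (nonrandom) positive definite matrix. Let $G$ be the one-step Newton map and define $\hat\delta_n = G(q_n,\tilde\delta_n)$. Then (a) $-\nabla^2 q_n(\tilde\delta_n)\stackrel{\mathcal{L}}{\longrightarrow}K$; (b) $-\nabla^2 q_n(\hat\delta_n)\stackrel{\mathcal{L}}{\longrightarrow}K$; (c) $\hat\delta_n\stackrel{\mathcal{L}}{\longrightarrow}\mathcal{N}(0,K^{-1})$; (d) $\bigl(-\nabla^2 q_n(\hat\delta_n)\bigr)^{1/2}\hat\delta_n\stackrel{\mathcal{L}}{\longrightarrow}\mathcal{N}(0,I)$, where the matrix square root in (d) is the symmetric square root when the matrix is positive definite and NaO otherwise, and $I$ is the $p\times p$ identity matrix. Moreover, the assumed convergence $(q_n,\tilde\delta_n)\stackrel{\mathcal{L}}{\longrightarrow}(q,\tilde\delta)$ and (a), (b), (c), (d) hold jointly; that is, for some random vectors $V\sim\mathcal{N}(0,K^{-1})$ and $W\sim\mathcal{N}(0,I)$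 defined jointly with $(q,\tilde\delta)$, $$\Bigl(q_n,\tilde\delta_n,-\nabla^2q_n(\tilde\delta_n),-\nabla^2q_n(\hat\delta_n),\hat\delta_n,\bigl(-\nabla^2 q_n(\hat\delta_n)\bigr)^{1/2}\hat\delta_n\Bigr)\stackrel{\mathcal{L}}{\longrightarrow}\bigl(q,\tilde\delta,K,K,V,W\bigr).$$
   Context: Convergence in law ($\stackrel{\mathcal{L}}{\longrightarrow}$) of random elements $X_n$ of a Polish space $S$ to a random element $X$ means $E f(X_n)\to E f(X)$ for every bounded continuous $f:S\to\mathbb{R}$; products of Polish spaces carry the product topology. $C^2(\mathbb{R}^p)$ is the Polish space of twice continuously differentiable functions $\mathbb{R}^p\to\mathbb{R}$ with the topology of uniform convergence on compact sets of the functions and their first and second partial derivatives. Log likelihoods: for a parametric model with almost surely positive densities $f_\delta$, $\delta\in\mathbb{R}^p$, with respect to a measure, the log likelihood is the random function $\delta\mapsto u(X)+\log f_\delta(X)$, with $X$ the data and $u$ any function not depending on $\delta$. It is regarded as a random element of $C^2(\mathbb{R}^p)$ whose law is that induced by the true parameter value (here zero). The models for different $n$ need have nothing to do with each other except having the same parameter space. LAMN model: a model whose log likelihood is $q(\delta)=\delta'Z-\tfrac12\delta'K\delta$ (up to an additive term not depending on $\delta$), with $Z$ a random $p$-vector and $K$ a (possibly random) symmetric $p\times p$ matrix, such that the distribution of $K$ does not depend on the parameter $\delta$ and, for parameter value $\delta$, the conditional distribution of $Z$ given $K$ is $\mathcal{N}(K\delta,K)$. In particular, for constant $K$ and true parameter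 value zero, $Z\sim\mathcal{N}(0,K)$. NaO ("not an object") is a special value added as an isolated point to a Polish space (giving a Polish space again); it propagates through all operations, i.e. any expression with an argument equal to NaO has value NaO. Quantities that may be NaO are random elements of the corresponding Euclidean or matrix space with the isolated point NaO added. One-step Newton map: for $q\in C^2(\mathbb{R}^p)$ and $\delta\in\mathbb{R}^p\cup\{\mathrm{NaO}\}$, $$G(q,\delta)=\delta+\bigl(-\nabla^2q(\delta)\bigr)^{-1}\nabla q(\delta)$$ when $\delta\ne\mathrm{NaO}$ and $-\nabla^2q(\delta)$ is positive definite, and $G(q,\delta)=\mathrm{NaO}$ otherwise. *)

theory Defs
  imports "HOL-Probability.Probability"
begin

definition grad :: "(real^'p \<Rightarrow> real) \<Rightarrow> real^'p \<Rightarrow> real^'p" where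
  "grad f x = (\<chi> i. frechet_derivative f (at x) (axis i 1))"

definition hess :: "(real^'p \<Rightarrow> real) \<Rightarrow> real^'p \<Rightarrow> real^'p^'p" where
  "hess f x = jacobian (grad f) (at x)"

definition twice_cont_diff :: "(real^'p \<Rightarrow> real) \<Rightarrow> bool" where
  "twice_cont_diff f \<longleftrightarrow>
     (\<forall>x. f differentiable (at x)) \<and> (\<forall>x. grad f differentiable (at x)) \<and>
     continuous_on UNIV (hess f)"

lemma twice_cont_diff_zero: "twice_cont_diff (\<lambda>_ :: real^'p. 0)"
proof -
  have g: "grad (\<lambda>_ :: real^'p. 0) = (\<lambda>_. 0)"
    by (simp add: grad_def fun_eq_iff vec_eq_iff frechet_derivative_const)
  have h: "hess (\<lambda>_ :: real^'p. 0) = (\<lambda>_. 0)"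
    by (simp add: hess_def g jacobian_def fun_eq_iff frechet_derivative_const matrix_def vec_eq_iff)
  show ?thesis
    by (simp add: twice_cont_diff_def g h)
qed

typedef (overloaded) 'p c2 = "{f :: real^'p::finite \<Rightarrow> real. twice_cont_diff f}"
  morphisms c2_fun Abs_c2
  using twice_cont_diff_zero by blast

definition c2_nhd :: "'p::finite c2 \<Rightarrow> (real^'p) set \<Rightarrow> real \<Rightarrow> 'p c2 set" where
  "c2_nhd f C e = {g. \<forall>x\<in>C. dist (c2_fun g x) (c2_fun f x) < e \<and>
     dist (grad (c2_fun g) x) (grad (c2_fun f) x) < e \<and>
     dist (hess (c2_fun g) x) (hess (c2_fun f) x) < e}"

text \<open>Uniform convergence on compact sets of the function, its gradient and its Hessian.\<close>

instantiation c2 :: (finite) topological_space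
begin

definition open_c2 :: "'a c2 set \<Rightarrow> bool" where
  "open_c2 U \<longleftrightarrow> (\<forall>f\<in>U. \<exists>C e. compact C \<and> e > 0 \<and> c2_nhd f C e \<subseteq> U)"

instance
proof
  show "open (UNIV :: 'a c2 set)"
    unfolding open_c2_def using compact_empty zero_less_one by blast
next
  fix S T :: "'a c2 set"
  assume S: "open S" and T: "open T"
  show "open (S \<inter> T)"
    unfolding open_c2_def
  proof
    fix f assume f: "f \<in> S \<inter> T"
    obtain C e where 1: "compact C" "e > 0" "c2_nhd f C e \<subseteq> S"
      using S f unfolding open_c2_def by blast
    obtain D d where 2: "compact D" "d > 0" "c2_nhd f D d \<subseteq> T"
      using T f unfolding open_c2_def by blast
    have "c2_nhd f (C \<union> D) (min e d) \<subseteq> c2_nhd f C e \<inter> c2_nhd f D d"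
      unfolding c2_nhd_def by auto
    then show "\<exists>C e. compact C \<and> e > 0 \<and> c2_nhd f C e \<subseteq> S \<inter> T"
      using 1 2 by (intro exI[of _ "C \<union> D"] exI[of _ "min e d"]) auto
  qed
next
  fix K :: "'a c2 set set"
  assume "\<forall>S\<in>K. open S"
  then show "open (\<Union>K)"
    unfolding open_c2_def by (meson UnionE Union_upper subset_trans)
qed

end

text \<open>A space with the extra value NaO is an \<open>option\<close> type. In the topology below \<open>Some\<close> is an
  open embedding and \<open>None\<close> is an isolated point.\<close>

abbreviation NaO :: "'a option" where
  "NaO \<equiv> None"

instantiation option :: (topological_space) topological_space
begin

definition open_option :: "'a option set \<Rightarrow> bool" where
  "open_option U \<longleftrightarrow> open (Some -` U)"

instance
proof
  show "open (UNIV :: 'a option set)"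
    by (simp add: open_option_def)
  show "open (S \<inter> T)" if "open S" "open T" for S T :: "'a option set"
    using that by (simp add: open_option_def open_Int)
  show "open (\<Union>K)" if "\<forall>S\<in>K. open S" for K :: "'a option set set"
    using that by (auto simp add: open_option_def vimage_Union)
qed

end

definition nao_mult_vec :: "(real^'p^'p) option \<Rightarrow> (real^'p) option \<Rightarrow> (real^'p) option" where
  "nao_mult_vec A x = Option.bind A (\<lambda>a. Option.bind x (\<lambda>v. Some (a *v v)))"

definition pos_def :: "real^'p^'p \<Rightarrow> bool" where
  "pos_def A \<longleftrightarrow> transpose A = A \<and> (\<forall>x. x \<noteq> 0 \<longrightarrow> 0 < x \<bullet> (A *v x))"

definition pos_semidef :: "real^'p^'p \<Rightarrow> bool" where
  "pos_semidef A \<longleftrightarrow> transpose A = A \<and> (\<forall>x. 0 \<le> x \<bullet> (A *v x))"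

text \<open>Only meaningful for positive semidefinite arguments, where the root exists and is unique.\<close>

definition matrix_sqrt :: "real^'p^'p \<Rightarrow> real^'p^'p" where
  "matrix_sqrt A = (THE B. pos_semidef B \<and> B ** B = A)"

definition nao_sqrt :: "(real^'p^'p) option \<Rightarrow> (real^'p^'p) option" where
  "nao_sqrt A = Option.bind A (\<lambda>a. if pos_def a then Some (matrix_sqrt a) else NaO)"

definition std_mv_normal :: "(real^'p) measure" where
  "std_mv_normal = density lborel (\<lambda>z. ennreal (\<Prod>i\<in>UNIV. std_normal_density (z $ i)))"

text \<open>The law of \<open>\<mu> + S\<^sup>1\<^sup>/\<^sup>2 \<zeta>\<close> with \<open>\<zeta>\<close> standard normal; the covariance matrix \<open>S\<close> is positive
  semidefinite and may be singular.\<close>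

definition mv_normal :: "real^'p \<Rightarrow> real^'p^'p \<Rightarrow> (real^'p) measure" where
  "mv_normal \<mu> S = distr std_mv_normal borel (\<lambda>z. \<mu> + matrix_sqrt S *v z)"

text \<open>The random elements may live on different probability spaces. Being a random element (Borel
  measurability) is part of the notion.\<close>

definition converges_in_law ::
  "(nat \<Rightarrow> 'a measure) \<Rightarrow> (nat \<Rightarrow> 'a \<Rightarrow> 's::topological_space) \<Rightarrow> 'b measure \<Rightarrow> ('b \<Rightarrow> 's) \<Rightarrow> bool" where
  "converges_in_law M X N Y \<longleftrightarrow>
     (\<forall>n. prob_space (M n) \<and> X n \<in> borel_measurable (M n)) \<and>
     prob_space N \<and> Y \<in> borel_measurable N \<and>
     (\<forall>f :: 's \<Rightarrow> real. continuous_on UNIV f \<longrightarrow> bounded (range f) \<longrightarrow>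
        (\<lambda>n. \<integral>\<omega>. f (X n \<omega>) \<partial>M n) \<longlonglongrightarrow> (\<integral>\<omega>. f (Y \<omega>) \<partial>N))"

abbreviation model_law :: "'x measure \<Rightarrow> (real^'p \<Rightarrow> 'x \<Rightarrow> real) \<Rightarrow> real^'p \<Rightarrow> 'x measure" where
  "model_law \<nu> f \<delta> \<equiv> density \<nu> (\<lambda>x. ennreal (f \<delta> x))"

text \<open>Almost sure positivity refers to every distribution in the model.\<close>

definition parametric_model :: "'x measure \<Rightarrow> (real^'p \<Rightarrow> 'x \<Rightarrow> real) \<Rightarrow> bool" where
  "parametric_model \<nu> f \<longleftrightarrow>
     (\<forall>\<delta>. f \<delta> \<in> borel_measurable \<nu> \<and> (\<forall>x\<in>space \<nu>. 0 \<le> f \<delta> x) \<and> prob_space (model_law \<nu> f \<delta>)) \<and>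
     (\<forall>\<delta> \<psi>. AE x in model_law \<nu> f \<psi>. 0 < f \<delta> x)"

text \<open>\<open>q\<close> is the log likelihood, as a random element of the space of twice continuously
  differentiable functions, for data \<open>X\<close> defined on the probability space \<open>M\<close> when \<open>\<theta>\<close> is the true
  parameter value. Off a null set the densities are positive simultaneously for all parameter values,
  so that the log likelihood is a finite function (the library has \<open>ln 0 = 0\<close>).
  The space \<open>M\<close> may carry more randomness than the data.\<close>

definition log_likelihood ::
  "'w measure \<Rightarrow> ('w \<Rightarrow> 'p::finite c2) \<Rightarrow> 'x measure \<Rightarrow> (real^'p \<Rightarrow> 'x \<Rightarrow> real) \<Rightarrow> ('w \<Rightarrow> 'x) \<Rightarrow> real^'p \<Rightarrow> bool" where
  "log_likelihood M q \<nu> f X \<theta> \<longleftrightarrow>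
     prob_space M \<and> q \<in> borel_measurable M \<and>
     parametric_model \<nu> f \<and>
     X \<in> measurable M \<nu> \<and> distr M \<nu> X = model_law \<nu> f \<theta> \<and>
     (\<exists>u. AE \<omega> in M. \<forall>\<delta>. 0 < f \<delta> (X \<omega>) \<and> c2_fun (q \<omega>) \<delta> = u (X \<omega>) + ln (f \<delta> (X \<omega>)))"

text \<open>The last conjunct says that, under the parameter value \<open>\<delta>\<close>, the conditional distribution of
  \<open>Z\<close> given \<open>K\<close> is normal with mean \<open>K \<delta>\<close> and variance \<open>K\<close>.\<close>

definition lamn_model ::
  "'x measure \<Rightarrow> (real^'p \<Rightarrow> 'x \<Rightarrow> real) \<Rightarrow> ('x \<Rightarrow> real^'p) \<Rightarrow> ('x \<Rightarrow> real^'p^'p) \<Rightarrow> bool" where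
  "lamn_model \<nu> f Z K \<longleftrightarrow>
     parametric_model \<nu> f \<and>
     Z \<in> borel_measurable \<nu> \<and> K \<in> borel_measurable \<nu> \<and>
     (\<forall>\<delta>. AE x in model_law \<nu> f \<delta>. pos_semidef (K x)) \<and>
     (\<exists>u. \<forall>\<psi>. AE x in model_law \<nu> f \<psi>. \<forall>\<delta>.
        0 < f \<delta> x \<and> u x + ln (f \<delta> x) = \<delta> \<bullet> Z x - (1/2) * (\<delta> \<bullet> (K x *v \<delta>))) \<and>
     (\<forall>\<delta>. distr (model_law \<nu> f \<delta>) borel K = distr (model_law \<nu> f 0) borel K) \<and>
     (\<forall>\<delta>. \<forall>A\<in>sets borel. \<forall>B\<in>sets borel.
        emeasure (model_law \<nu> f \<delta>) {x \<in> space \<nu>. K x \<in> B \<and> Z x \<in> A} =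
        (\<integral>\<^sup>+x. indicator B (K x) * emeasure (mv_normal (K x *v \<delta>) (K x)) A \<partial>model_law \<nu> f \<delta>))"

definition neg_hess :: "'p::finite c2 \<Rightarrow> real^'p \<Rightarrow> real^'p^'p" where
  "neg_hess q \<delta> = - hess (c2_fun q) \<delta>"

definition newton_step :: "'p::finite c2 \<Rightarrow> (real^'p) option \<Rightarrow> (real^'p) option" where
  "newton_step q d = Option.bind d (\<lambda>\<delta>.
     if pos_def (neg_hess q \<delta>)
     then Some (\<delta> + matrix_inv (neg_hess q \<delta>) *v grad (c2_fun q) \<delta>) else NaO)"

end

theory Submission
  imports Defs
begin

text \<open>
  All components of the joint statement are values of one map \<open>newton_statistics\<close> at
  \<open>(q\<^sub>n, \<delta>tilde\<^sub>n)\<close>, so the theorem is an application of the continuous mapping theorem. In the limit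
  the log likelihood is quadratic with the constant curvature \<open>K\<close>, hence one Newton step from any
  starting point ends in the maximum \<open>V = K\<^sup>-\<^sup>1 Z\<close>. At true parameter value zero \<open>Z\<close> is normal with
  mean zero and variance \<open>K\<close>, so \<open>V\<close> has variance \<open>K\<^sup>-\<^sup>1\<close> and
  \<open>W = K\<^sup>1\<^sup>/\<^sup>2 V\<close> is standard normal. The starting points only influence the limit through their own
  component.

  The map is discontinuous where a Newton step or a square root fails and NaO appears. The limit
  stays away from these places: its observed information is \<open>K\<close> everywhere. This is made quantitative by a
  continuous cutoff function (\<open>newton_cutoff_exists\<close>) that is 1 at the limit and supported where the map is
  continuous, and \<open>converges_in_law_mapping\<close> is the mapping theorem for such a cutoff.

  Continuity on the remaining region rests on three facts. Evaluation of gradients and Hessians is jointly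
  continuous on \<open>C\<^sup>2\<close> times the parameter space (\<open>continuous_on_c2_evaluation\<close>). Hessians are
  symmetric (\<open>transpose_neg_hess\<close>), so positive definiteness of the observed information is an open
  condition. Inverse and square root are continuous on positive definite matrices
  (\<open>continuous_on_matrix_inv_mult\<close>, \<open>continuous_on_matrix_sqrt\<close>); for the square root this follows
  from the estimate \<open>norm_diff_le_norm_square_diff\<close>, which also shows its uniqueness.
\<close>

section \<open>Gradients and Hessians\<close>

lemma matrix_vector_mult_minus_left: "(- A) *v x = - (A *v x)" for A :: "real^'n^'m"
  by (simp add: matrix_vector_mult_def vec_eq_iff sum_negf)

lemma bounded_bilinear_matrix_vector_mult:
  "bounded_bilinear ((*v) :: real^'n::finite^'m::finite \<Rightarrow> _)"
  unfolding bilinear_conv_bounded_bilinear[symmetric] bilinear_def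
  by (auto intro!: linearI simp: algebra_simps scaleR_matrix_vector_assoc)

lemmas continuous_on_matrix_vector_mult [continuous_intros] =
  bounded_bilinear.continuous_on[OF bounded_bilinear_matrix_vector_mult]

lemmas continuous_matrix_vector_mult =
  bounded_bilinear.continuous[OF bounded_bilinear_matrix_vector_mult]

lemma twice_cont_diff_c2_fun: "twice_cont_diff (c2_fun f)"
  using c2_fun[of f] by simp

lemma has_derivative_grad:
  fixes f :: "real^'p::finite \<Rightarrow> real"
  assumes "f differentiable (at x)"
  shows "(f has_derivative (\<lambda>v. grad f x \<bullet> v)) (at x)"
proof -
  let ?D = "frechet_derivative f (at x)"
  have D: "(f has_derivative ?D) (at x)"
    using assms by (simp add: frechet_derivative_works)
  interpret D: linear ?D
    using D by (rule has_derivative_linear)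
  have "?D v = grad f x \<bullet> v" for v
  proof -
    have "?D v = ?D (\<Sum>i\<in>UNIV. (v $ i) *\<^sub>R axis i 1)"
      using basis_expansion[of v] by (simp add: scalar_mult_eq_scaleR)
    then show ?thesis
      by (simp add: D.sum D.scaleR grad_def inner_vec_def mult.commute)
  qed
  then show ?thesis
    using D by (metis (no_types, lifting) ext)
qed

lemma grad_eqI:
  assumes "(f has_derivative (\<lambda>v. g \<bullet> v)) (at x)"
  shows "grad f x = g"
  using frechet_derivative_at[OF assms, symmetric] by (simp add: grad_def vec_eq_iff inner_axis)

lemma has_derivative_hess:
  assumes "grad f differentiable (at x)"
  shows "(grad f has_derivative (\<lambda>v. hess f x *v v)) (at x)"
  using assms by (simp add: hess_def jacobian_works)

lemma hess_eqI:
  assumes "(grad f has_derivative (\<lambda>v. A *v v)) (at x)"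
  shows "hess f x = A"
  using frechet_derivative_at[OF assms, symmetric] by (simp add: hess_def jacobian_def)

lemma twice_cont_diff_continuous:
  assumes "twice_cont_diff f"
  shows "continuous_on UNIV f" "continuous_on UNIV (grad f)" "continuous_on UNIV (hess f)"
  using assms unfolding twice_cont_diff_def
  by (auto intro!: differentiable_imp_continuous_on simp: differentiable_on_def)

section \<open>Joint continuity of evaluation on $C^2$\<close>

text \<open>By compactness, the three deviations of \<open>g\<close> from \<open>f\<close> stay below \<open>e\<close> by a uniform margin, and a
  function closer to \<open>g\<close> than this margin is still in the set.\<close>

lemma open_c2_nhd:
  fixes f :: "'p::finite c2"
  assumes "compact C"
  shows "open (c2_nhd f C e)"
  unfolding open_c2_def
proof
  fix g assume g: "g \<in> c2_nhd f C e"
  define d where "d x = max (dist (c2_fun g x) (c2_fun f x))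
    (max (dist (grad (c2_fun g) x) (grad (c2_fun f) x)) (dist (hess (c2_fun g) x) (hess (c2_fun f) x)))" for x
  have d: "d x < e" if "x \<in> C" for x
    using g that by (auto simp: c2_nhd_def d_def)
  have "continuous_on C d"
    unfolding d_def
    by (intro continuous_intros; rule continuous_on_subset[OF _ subset_UNIV])
      (simp_all add: twice_cont_diff_continuous[OF twice_cont_diff_c2_fun])
  have "\<exists>r>0. \<forall>x\<in>C. d x + r \<le> e"
  proof (cases "C = {}")
    case True
    then show ?thesis using zero_less_one by blast
  next
    case False
    then obtain x where "x \<in> C" "\<And>y. y \<in> C \<Longrightarrow> d y \<le> d x"
      using continuous_attains_sup[OF assms _ \<open>continuous_on C d\<close>] by blast
    then show ?thesis
      using d[of x] by (intro exI[of _ "e - d x"]) auto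
  qed
  then obtain r where r: "r > 0" "\<And>x. x \<in> C \<Longrightarrow> d x + r \<le> e" by blast
  have "c2_nhd g C r \<subseteq> c2_nhd f C e"
  proof
    fix h assume h: "h \<in> c2_nhd g C r"
    have "dist (c2_fun h x) (c2_fun f x) < e \<and> dist (grad (c2_fun h) x) (grad (c2_fun f) x) < e \<and>
      dist (hess (c2_fun h) x) (hess (c2_fun f) x) < e" if x: "x \<in> C" for x
      using h x r(2)[OF x] dist_triangle[of "c2_fun h x" "c2_fun f x" "c2_fun g x"]
        dist_triangle[of "grad (c2_fun h) x" "grad (c2_fun f) x" "grad (c2_fun g) x"]
        dist_triangle[of "hess (c2_fun h) x" "hess (c2_fun f) x" "hess (c2_fun g) x"]
      unfolding c2_nhd_def d_def by (fastforce simp: max_def split: if_splits)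
    then show "h \<in> c2_nhd f C e" by (simp add: c2_nhd_def)
  qed
  then show "\<exists>C' e'. compact C' \<and> e' > 0 \<and> c2_nhd g C' e' \<subseteq> c2_nhd f C e"
    using assms r(1) by blast
qed

text \<open>Uniform convergence on a compact neighbourhood of \<open>d\<close>, together with continuity of the derivative at
  \<open>d\<close>, gives convergence when the function and the point vary together. The parameter \<open>T\<close> stands for
  the gradient and for the Hessian.\<close>

lemma continuous_on_c2_evaluation:
  fixes T :: "(real^'p::finite \<Rightarrow> real) \<Rightarrow> real^'p \<Rightarrow> 'b::metric_space"
  assumes cont: "\<And>f :: 'p c2. continuous_on UNIV (T (c2_fun f))"
    and nhd: "\<And>(f :: 'p c2) g C e x. g \<in> c2_nhd f C e \<Longrightarrow> x \<in> C \<Longrightarrow> dist (T (c2_fun g) x) (T (c2_fun f) x) < e"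
  shows "continuous_on UNIV (\<lambda>z :: 'p c2 \<times> (real^'p). T (c2_fun (fst z)) (snd z))"
proof -
  have "((\<lambda>z. T (c2_fun (fst z)) (snd z)) \<longlongrightarrow> T (c2_fun (fst (q, d))) (snd (q, d))) (at (q, d))"
    for q :: "'p c2" and d
    unfolding tendsto_iff
  proof (intro allI impI)
    fix e :: real assume "e > 0"
    let ?A = "c2_nhd q (cball d 1) (e/2)"
    let ?B = "ball d 1 \<inter> {x. dist (T (c2_fun q) x) (T (c2_fun q) d) < e/2}"
    have "open {x. dist (T (c2_fun q) x) (T (c2_fun q) d) < e/2}"
      by (intro open_Collect_less continuous_intros cont)
    then have "open (?A \<times> ?B)"
      by (intro open_Times open_c2_nhd open_Int) auto
    moreover have "(q, d) \<in> ?A \<times> ?B"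
      using \<open>e > 0\<close> by (simp add: c2_nhd_def)
    ultimately have "eventually (\<lambda>z. z \<in> ?A \<times> ?B) (at (q, d))"
      by (rule eventually_at_in_open')
    then show "eventually (\<lambda>z. dist (T (c2_fun (fst z)) (snd z)) (T (c2_fun (fst (q, d))) (snd (q, d))) < e) (at (q, d))"
    proof eventually_elim
      case (elim z)
      then have "dist (T (c2_fun (fst z)) (snd z)) (T (c2_fun q) (snd z)) < e/2"
        by (intro nhd) (auto simp: less_imp_le)
      then show ?case
        using elim dist_triangle[of "T (c2_fun (fst z)) (snd z)" "T (c2_fun q) d" "T (c2_fun q) (snd z)"]
        by auto
    qed
  qed
  then show ?thesis
    by (auto simp: continuous_on_def)
qed

lemma continuous_on_grad_c2:
  "continuous_on UNIV (\<lambda>z :: 'p::finite c2 \<times> (real^'p). grad (c2_fun (fst z)) (snd z))"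
  by (rule continuous_on_c2_evaluation)
    (auto simp: c2_nhd_def twice_cont_diff_continuous[OF twice_cont_diff_c2_fun])

lemma continuous_on_neg_hess:
  "continuous_on UNIV (\<lambda>z :: 'p::finite c2 \<times> (real^'p). neg_hess (fst z) (snd z))"
  unfolding neg_hess_def
  by (intro continuous_intros continuous_on_c2_evaluation)
    (auto simp: c2_nhd_def twice_cont_diff_continuous[OF twice_cont_diff_c2_fun])

section \<open>Symmetry of the Hessian\<close>

text \<open>The mean value theorem, applied first in direction \<open>u\<close> and then in direction \<open>v\<close>. The left-hand side
  is symmetric in \<open>u\<close> and \<open>v\<close>, which forces the Hessian to be symmetric in the limit \<open>t \<rightarrow> 0\<close>.\<close>

lemma second_difference_eq_hess:
  fixes f :: "real^'p::finite \<Rightarrow> real"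
  assumes f: "twice_cont_diff f" and t: "t > 0"
  shows "\<exists>r s. 0 < r \<and> r < t \<and> 0 < s \<and> s < t \<and>
    f (x + t *\<^sub>R u + t *\<^sub>R v) - f (x + t *\<^sub>R u) - f (x + t *\<^sub>R v) + f x
      = t\<^sup>2 * (u \<bullet> (hess f (x + r *\<^sub>R u + s *\<^sub>R v) *v v))"
proof -
  have df: "(f has_derivative (\<lambda>h. grad f y \<bullet> h)) (at y)" for y
    using f by (auto simp: twice_cont_diff_def intro: has_derivative_grad)
  have dg: "(grad f has_derivative (\<lambda>h. hess f y *v h)) (at y)" for y
    using f by (auto simp: twice_cont_diff_def intro: has_derivative_hess)
  define \<phi> where "\<phi> r = f (x + r *\<^sub>R u + t *\<^sub>R v) - f (x + r *\<^sub>R u)" for r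
  have "(\<phi> has_field_derivative (u \<bullet> grad f (x + r *\<^sub>R u + t *\<^sub>R v) - u \<bullet> grad f (x + r *\<^sub>R u))) (at r)" for r
  proof -
    have "((\<lambda>r. f (x + r *\<^sub>R u + t *\<^sub>R v)) has_derivative (\<lambda>h. grad f (x + r *\<^sub>R u + t *\<^sub>R v) \<bullet> (h *\<^sub>R u))) (at r)"
      by (rule has_derivative_compose[OF _ df]) (auto intro!: derivative_eq_intros)
    moreover have "((\<lambda>r. f (x + r *\<^sub>R u)) has_derivative (\<lambda>h. grad f (x + r *\<^sub>R u) \<bullet> (h *\<^sub>R u))) (at r)"
      by (rule has_derivative_compose[OF _ df]) (auto intro!: derivative_eq_intros)
    ultimately show ?thesis
      unfolding \<phi>_def has_field_derivative_def
      by (rule has_derivative_eq_rhs[OF has_derivative_diff]) (auto simp: inner_commute algebra_simps)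
  qed
  from MVT2[OF t this] obtain r where r: "0 < r" "r < t"
    and \<phi>: "\<phi> t - \<phi> 0 = t * (u \<bullet> grad f (x + r *\<^sub>R u + t *\<^sub>R v) - u \<bullet> grad f (x + r *\<^sub>R u))"
    by auto
  define \<psi> where "\<psi> s = u \<bullet> grad f (x + r *\<^sub>R u + s *\<^sub>R v)" for s
  have "(\<psi> has_field_derivative (u \<bullet> (hess f (x + r *\<^sub>R u + s *\<^sub>R v) *v v))) (at s)" for s
  proof -
    have "((\<lambda>s. grad f (x + r *\<^sub>R u + s *\<^sub>R v)) has_derivative (\<lambda>h. hess f (x + r *\<^sub>R u + s *\<^sub>R v) *v (h *\<^sub>R v))) (at s)"
      by (rule has_derivative_compose[OF _ dg]) (auto intro!: derivative_eq_intros)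
    then show ?thesis
      unfolding \<psi>_def has_field_derivative_def
      by (rule has_derivative_eq_rhs[OF has_derivative_inner_right])
        (auto simp: matrix_vector_mult_scaleR mult.commute)
  qed
  from MVT2[OF t this] obtain s where s: "0 < s" "s < t"
    and \<psi>: "\<psi> t - \<psi> 0 = t * (u \<bullet> (hess f (x + r *\<^sub>R u + s *\<^sub>R v) *v v))"
    by auto
  show ?thesis
    using r s \<phi> \<psi> by (intro exI[of _ r] exI[of _ s]) (simp add: \<phi>_def \<psi>_def power2_eq_square)
qed

lemma hess_symmetric_bilinear:
  fixes f :: "real^'p::finite \<Rightarrow> real"
  assumes f: "twice_cont_diff f"
  shows "u \<bullet> (hess f x *v v) = v \<bullet> (hess f x *v u)"
proof -
  define \<Delta> where "\<Delta> t u v = (f (x + t *\<^sub>R u + t *\<^sub>R v) - f (x + t *\<^sub>R u) - f (x + t *\<^sub>R v) + f x) / t\<^sup>2" for t u v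
  have lim: "((\<lambda>t. \<Delta> t u v) \<longlongrightarrow> u \<bullet> (hess f x *v v)) (at_right 0)" for u v
  proof -
    have "\<exists>rs. t > 0 \<longrightarrow> 0 < fst rs \<and> fst rs < t \<and> 0 < snd rs \<and> snd rs < t \<and>
      \<Delta> t u v = u \<bullet> (hess f (x + fst rs *\<^sub>R u + snd rs *\<^sub>R v) *v v)" for t
      using second_difference_eq_hess[OF f, of t x u v] by (force simp: \<Delta>_def)
    then obtain rs where rs: "\<And>t. t > 0 \<Longrightarrow> 0 < fst (rs t) \<and> fst (rs t) < t \<and> 0 < snd (rs t) \<and> snd (rs t) < t \<and>
      \<Delta> t u v = u \<bullet> (hess f (x + fst (rs t) *\<^sub>R u + snd (rs t) *\<^sub>R v) *v v)"
      by metis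
    have pos: "eventually (\<lambda>t::real. t > 0) (at_right 0)"
      by (simp add: eventually_at_right_less)
    have r0: "((\<lambda>t. fst (rs t)) \<longlongrightarrow> 0) (at_right 0)"
      by (rule tendsto_sandwich[OF _ _ tendsto_const tendsto_ident_at])
        (use pos in eventually_elim, use rs in \<open>auto simp: less_imp_le\<close>)+
    have s0: "((\<lambda>t. snd (rs t)) \<longlongrightarrow> 0) (at_right 0)"
      by (rule tendsto_sandwich[OF _ _ tendsto_const tendsto_ident_at])
        (use pos in eventually_elim, use rs in \<open>auto simp: less_imp_le\<close>)+
    have "((\<lambda>t. x + fst (rs t) *\<^sub>R u + snd (rs t) *\<^sub>R v) \<longlongrightarrow> x + 0 *\<^sub>R u + 0 *\<^sub>R v) (at_right 0)"
      by (intro tendsto_intros r0 s0)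
    moreover have "isCont (\<lambda>y. u \<bullet> (hess f y *v v)) x"
      using twice_cont_diff_continuous(3)[OF f]
      by (auto simp: continuous_on_eq_continuous_at intro!: continuous_inner continuous_matrix_vector_mult)
    ultimately have "((\<lambda>t. u \<bullet> (hess f (x + fst (rs t) *\<^sub>R u + snd (rs t) *\<^sub>R v) *v v)) \<longlongrightarrow> u \<bullet> (hess f x *v v)) (at_right 0)"
      by (intro isCont_tendsto_compose[where g = "\<lambda>y. u \<bullet> (hess f y *v v)"]) auto
    then show ?thesis
      by (rule tendsto_cong[THEN iffD1, rotated]) (use pos in eventually_elim, use rs in auto)
  qed
  have "\<Delta> t u v = \<Delta> t v u" for t
    by (simp add: \<Delta>_def algebra_simps)
  then have "((\<lambda>t. \<Delta> t u v) \<longlongrightarrow> v \<bullet> (hess f x *v u)) (at_right 0)"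
    using lim[of v u] by simp
  with lim[of u v] show ?thesis
    by (rule tendsto_unique[OF trivial_limit_at_right_real])
qed

lemma symmetric_matrixI:
  fixes A :: "real^'p::finite^'p"
  assumes "\<And>u v. u \<bullet> (A *v v) = v \<bullet> (A *v u)"
  shows "transpose A = A"
  using assms[of "axis _ 1" "axis _ 1"]
  by (simp add: vec_eq_iff transpose_def inner_axis' matrix_vector_mult_basis column_def)

text \<open>Positive definiteness includes symmetry, a closed condition. Since Hessians are symmetric anyway, only
  the open condition of positivity matters for them, so that a log likelihood close to one with positive
  definite observed information has positive definite observed information, too.\<close>

lemma transpose_neg_hess: "transpose (neg_hess q x) = neg_hess q x"
proof (rule symmetric_matrixI)
  fix u v
  show "u \<bullet> (neg_hess q x *v v) = v \<bullet> (neg_hess q x *v u)"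
    using hess_symmetric_bilinear[OF twice_cont_diff_c2_fun[of q], of u x v]
    by (simp add: neg_hess_def matrix_vector_mult_minus_left)
qed

section \<open>Positive definite matrices\<close>

text \<open>The minimum of the quadratic form on the unit sphere serves as \<open>c\<close>.\<close>

lemma positive_form_coercive:
  fixes A :: "real^'p::finite^'p"
  assumes "\<And>x. x \<noteq> 0 \<Longrightarrow> 0 < x \<bullet> (A *v x)"
  obtains c where "c > 0" "\<And>x. c * (norm x)\<^sup>2 \<le> x \<bullet> (A *v x)"
proof -
  obtain u :: "real^'p" where u: "norm u = 1" "\<And>y. norm y = 1 \<Longrightarrow> u \<bullet> (A *v u) \<le> y \<bullet> (A *v y)"
  proof -
    have "continuous_on (sphere 0 1) (\<lambda>x. x \<bullet> (A *v x))"
      by (intro continuous_intros)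
    moreover have "sphere (0 :: real^'p) 1 \<noteq> {}" by simp
    ultimately obtain u where "u \<in> sphere 0 1" "\<forall>y\<in>sphere 0 1. u \<bullet> (A *v u) \<le> y \<bullet> (A *v y)"
      using continuous_attains_inf[OF compact_sphere, of 0 1 "\<lambda>x. x \<bullet> (A *v x)"] by blast
    then show ?thesis
      by (intro that[of u]) auto
  qed
  show ?thesis
  proof
    show "0 < u \<bullet> (A *v u)" using u(1) by (intro assms) auto
    show "u \<bullet> (A *v u) * (norm x)\<^sup>2 \<le> x \<bullet> (A *v x)" for x
    proof (cases "x = 0")
      case False
      have "u \<bullet> (A *v u) \<le> (x /\<^sub>R norm x) \<bullet> (A *v (x /\<^sub>R norm x))"
        using False by (intro u) simp
      also have "\<dots> = (x \<bullet> (A *v x)) / (norm x)\<^sup>2"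
        by (simp add: matrix_vector_mult_scaleR power2_eq_square divide_inverse)
      finally show ?thesis using False by (simp add: field_simps)
    qed simp
  qed
qed

lemma norm_matrix_vector_mult_le:
  obtains C where "C > 0" "\<And>(A :: real^'n::finite^'m::finite) x. norm (A *v x) \<le> norm A * norm x * C"
  using bounded_bilinear.pos_bounded[OF bounded_bilinear_matrix_vector_mult] by metis

lemma open_positive_matrices:
  "open {A :: real^'p::finite^'p. \<forall>x. x \<noteq> 0 \<longrightarrow> 0 < x \<bullet> (A *v x)}" (is "open ?P")
  unfolding open_dist
proof
  fix A assume "A \<in> ?P"
  then obtain c where c: "c > 0" "\<And>x. c * (norm x)\<^sup>2 \<le> x \<bullet> (A *v x)"
    using positive_form_coercive[of A] by auto
  obtain C where C: "C > 0" "\<And>(A :: real^'p^'p) x. norm (A *v x) \<le> norm A * norm x * C"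
    using norm_matrix_vector_mult_le by blast
  have "B \<in> ?P" if B: "dist B A < c / C" for B
  proof (clarsimp)
    fix x :: "real^'p" assume x: "x \<noteq> 0"
    have "\<bar>x \<bullet> ((B - A) *v x)\<bar> \<le> norm x * (norm (B - A) * norm x * C)"
      by (meson C(2) Cauchy_Schwarz_ineq2 mult_left_mono norm_ge_zero order_trans)
    also have "\<dots> = (norm (B - A) * C) * (norm x)\<^sup>2"
      by (simp add: power2_eq_square)
    also have "\<dots> < c * (norm x)\<^sup>2"
      using B C(1) x by (simp add: dist_norm field_simps)
    finally show "0 < x \<bullet> (B *v x)"
      using c(2)[of x] by (simp add: algebra_simps)
  qed
  then show "\<exists>e>0. \<forall>B. dist B A < e \<longrightarrow> B \<in> ?P"
    using c(1) C(1) by (intro exI[of _ "c / C"]) auto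
qed

lemma pos_def_imp_pos_semidef: "pos_def A \<Longrightarrow> pos_semidef A"
  unfolding pos_def_def pos_semidef_def
proof (intro conjI allI; elim conjE)
  show "0 \<le> x \<bullet> (A *v x)" if "\<forall>x. x \<noteq> 0 \<longrightarrow> 0 < x \<bullet> (A *v x)" for x
    using that by (cases "x = 0") (simp_all add: less_imp_le)
qed

lemma pos_def_invertible:
  fixes A :: "real^'p::finite^'p"
  assumes "pos_def A"
  shows "invertible A"
proof -
  have "x = 0" if "A *v x = 0" for x
  proof (rule ccontr)
    assume "x \<noteq> 0"
    then have "0 < x \<bullet> (A *v x)" using assms by (simp add: pos_def_def)
    then show False using that by simp
  qed
  then have "inj ((*v) A)"
    by (simp add: linear_injective_0[OF matrix_vector_mul_linear])
  then show ?thesis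
    by (simp add: invertible_left_inverse matrix_left_invertible_injective)
qed

lemma matrix_inv_mult:
  fixes A :: "real^'p::finite^'p"
  assumes "pos_def A"
  shows "A ** matrix_inv A = mat 1" "matrix_inv A ** A = mat 1"
  using someI_ex[OF pos_def_invertible[OF assms, unfolded invertible_def]]
  unfolding matrix_inv_def by auto

lemma matrix_inv_eqI:
  fixes A :: "real^'p::finite^'p"
  assumes "pos_def A" "A ** B = mat 1"
  shows "matrix_inv A = B"
  by (metis assms matrix_inv_mult(2) matrix_mul_assoc matrix_mul_lid matrix_mul_rid)

lemma continuous_on_det:
  fixes F :: "'s::topological_space \<Rightarrow> real^'p::finite^'p"
  assumes "continuous_on S F"
  shows "continuous_on S (\<lambda>x. det (F x))"
  unfolding det_def by (intro continuous_intros assms)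

text \<open>Cramer's rule exhibits the solution of the linear system as a quotient of determinants.\<close>

lemma continuous_on_matrix_inv_mult:
  fixes A :: "'s::topological_space \<Rightarrow> real^'p::finite^'p"
  assumes A: "continuous_on S A" and b: "continuous_on S b"
    and pd: "\<And>x. x \<in> S \<Longrightarrow> pos_def (A x)"
  shows "continuous_on S (\<lambda>x. matrix_inv (A x) *v b x)"
proof -
  have det: "det (A x) \<noteq> 0" if "x \<in> S" for x
    using pos_def_invertible[OF pd[OF that]] by (simp add: invertible_det_nz)
  have eq: "matrix_inv (A x) *v b x = (\<chi> k. det (\<chi> i j. if j = k then b x $ i else A x $ i $ j) / det (A x))"
    if "x \<in> S" for x
    using cramer[OF det[OF that], of "matrix_inv (A x) *v b x" "b x"]
    by (simp add: matrix_vector_mul_assoc matrix_inv_mult[OF pd[OF that]])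
  have "continuous_on S (\<lambda>x. \<chi> k. det (\<chi> i j. if j = k then b x $ i else A x $ i $ j) / det (A x))"
  proof (intro continuous_on_vec_lambda continuous_on_divide continuous_on_det A ballI det)
    fix i j k
    show "continuous_on S (\<lambda>x. if j = k then b x $ i else A x $ i $ j)"
      by (cases "j = k") (simp_all, intro continuous_intros b, intro continuous_intros A)
  qed
  then show ?thesis
    by (simp add: eq cong: continuous_on_cong)
qed

section \<open>Square roots of positive definite matrices\<close>

text \<open>Right multiplication by a symmetric matrix acts on each row separately. As the norm of a matrix is the
  Euclidean norm of all its entries, bounds for the action of \<open>S\<close> on vectors therefore turn into
  bounds for \<open>D ** S\<close> with the same constants.\<close>

lemma matrix_mult_row:
  fixes D S :: "real^'p::finite^'p"
  assumes "transpose S = S"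
  shows "(D ** S) $ i = S *v (D $ i)"
proof -
  have "(D ** S) $ i = (D $ i) v* S"
    by (simp add: vec_eq_iff matrix_matrix_mult_def vector_matrix_mult_def mult.commute)
  then show ?thesis
    by (metis assms transpose_matrix_vector)
qed

lemma inner_transpose: "transpose A \<bullet> transpose B = A \<bullet> (B :: real^'m::finite^'n::finite)"
  unfolding inner_vec_def transpose_def by (simp, subst sum.swap, simp)

lemma norm_transpose: "norm (transpose A) = norm (A :: real^'m::finite^'n::finite)"
  by (simp add: norm_eq_sqrt_inner inner_transpose)

lemma inner_mult_symmetric_ge:
  fixes D S :: "real^'p::finite^'p"
  assumes S: "transpose S = S" and c: "\<And>x. c * (norm x)\<^sup>2 \<le> x \<bullet> (S *v x)"
  shows "c * (norm D)\<^sup>2 \<le> D \<bullet> (D ** S)"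
proof -
  have "c * (norm D)\<^sup>2 = (\<Sum>i\<in>UNIV. c * (norm (D $ i))\<^sup>2)"
    by (simp add: dot_square_norm[symmetric] inner_vec_def[of D] sum_distrib_left)
  also have "\<dots> \<le> (\<Sum>i\<in>UNIV. D $ i \<bullet> (S *v (D $ i)))"
    by (intro sum_mono c)
  finally show ?thesis
    by (simp add: inner_vec_def[of D] matrix_mult_row[OF S])
qed

lemma norm_mult_symmetric_le:
  fixes D S :: "real^'p::finite^'p"
  assumes S: "transpose S = S" and r: "\<And>x. norm (S *v x) \<le> r * norm x" "0 \<le> r"
  shows "norm (D ** S) \<le> r * norm D"
proof -
  have "norm (D ** S) = L2_set (\<lambda>i. norm (S *v (D $ i))) UNIV"
    by (simp add: norm_vec_def[of "D ** S"] matrix_mult_row[OF S])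
  also have "\<dots> \<le> L2_set (\<lambda>i. r * norm (D $ i)) UNIV"
    by (intro L2_set_mono r norm_ge_zero)
  also have "\<dots> = r * norm D"
    by (simp add: L2_set_right_distrib r norm_vec_def[of D])
  finally show ?thesis .
qed

lemma matrix_mult_diff_left: "(A - B) ** C = A ** C - B ** (C :: real^'n^'m)" for A B :: "real^'m^'k"
  by (simp add: vec_eq_iff matrix_matrix_mult_def left_diff_distrib sum_subtractf)

lemma matrix_mult_diff_right: "C ** (A - B) = C ** A - C ** (B :: real^'n^'m)" for C :: "real^'m^'k"
  by (simp add: vec_eq_iff matrix_matrix_mult_def right_diff_distrib sum_subtractf)

lemma matrix_square_diff:
  fixes S T :: "real^'p::finite^'p"
  shows "S ** S - T ** T = S ** (S - T) + (S - T) ** T"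
  by (simp add: matrix_mult_diff_left matrix_mult_diff_right)

text \<open>With \<open>D = S - T\<close>, pairing the identity \<open>S\<^sup>2 - T\<^sup>2 = S D + D T\<close> with \<open>D\<close> leaves two nonnegative
  terms, the first of which is at least \<open>c\<close> times the squared norm of \<open>D\<close>. This yields
  both the uniqueness of square roots and their local Lipschitz dependence on the matrix.\<close>

lemma norm_diff_le_norm_square_diff:
  fixes S T :: "real^'p::finite^'p"
  assumes S: "transpose S = S" and c: "\<And>x. c * (norm x)\<^sup>2 \<le> x \<bullet> (S *v x)"
    and T: "pos_semidef T"
  shows "c * norm (S - T) \<le> norm (S ** S - T ** T)"
proof -
  let ?D = "S - T"
  have T': "transpose T = T" "\<And>x. 0 * (norm x)\<^sup>2 \<le> x \<bullet> (T *v x)"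
    using T by (auto simp: pos_semidef_def)
  have D: "transpose ?D = ?D"
    using S T'(1) by (simp add: transpose_def vec_eq_iff)
  have "transpose (S ** ?D) = ?D ** S"
    using S D by (simp add: matrix_transpose_mul)
  then have "?D \<bullet> (S ** ?D) = ?D \<bullet> (?D ** S)"
    by (metis D inner_transpose)
  then have "?D \<bullet> (S ** S - T ** T) = ?D \<bullet> (?D ** S) + ?D \<bullet> (?D ** T)"
    by (simp add: matrix_square_diff inner_add_right)
  moreover have "c * (norm ?D)\<^sup>2 \<le> ?D \<bullet> (?D ** S)"
    by (rule inner_mult_symmetric_ge[OF S c])
  moreover have "0 * (norm ?D)\<^sup>2 \<le> ?D \<bullet> (?D ** T)"
    by (rule inner_mult_symmetric_ge[OF T'])
  ultimately have "c * (norm ?D)\<^sup>2 \<le> ?D \<bullet> (S ** S - T ** T)" by simp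
  also have "\<dots> \<le> norm ?D * norm (S ** S - T ** T)"
    by (rule norm_cauchy_schwarz)
  finally have le: "c * (norm ?D)\<^sup>2 \<le> norm ?D * norm (S ** S - T ** T)" .
  show ?thesis
  proof (cases "?D = 0")
    case True
    then show ?thesis by simp
  next
    case False
    have "norm ?D * (c * norm ?D) \<le> norm ?D * norm (S ** S - T ** T)"
      using le
      by (simp only: power2_eq_square ac_simps)
    then show ?thesis
      by (rule mult_left_le_imp_le) (use False in simp)
  qed
qed

text \<open>If \<open>c\<close> is a lower bound for the quadratic form and \<open>m\<close> bounds the operator norm, then
  \<open>\<parallel>x - t A x\<parallel>\<^sup>2 \<le> (1 - 2 t c + t\<^sup>2 m\<^sup>2) \<parallel>x\<parallel>\<^sup>2\<close>, and \<open>t = c / m\<^sup>2\<close> minimizes the factor.\<close>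

lemma pos_def_contraction:
  fixes A :: "real^'p::finite^'p"
  assumes A: "pos_def A"
  obtains t r where "t > 0" "0 \<le> r" "r < 1" "\<And>x. norm ((mat 1 - t *\<^sub>R A) *v x) \<le> r * norm x"
proof -
  obtain c where c: "c > 0" "\<And>x. c * (norm x)\<^sup>2 \<le> x \<bullet> (A *v x)"
    using A positive_form_coercive[of A] by (auto simp: pos_def_def)
  obtain C where C: "C > 0" "\<And>(A :: real^'p^'p) x. norm (A *v x) \<le> norm A * norm x * C"
    using norm_matrix_vector_mult_le by blast
  \<comment> \<open>The maximum with \<open>c\<close> keeps \<open>1 - c\<^sup>2 / m\<^sup>2\<close> nonnegative and \<open>m\<close> positive.\<close>
  define m where "m = max c (norm A * C)"
  have m: "m > 0" "c \<le> m" "norm (A *v x) \<le> m * norm x" for x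
  proof -
    show "m > 0" "c \<le> m" using c by (auto simp: m_def)
    have "norm A * C * norm x \<le> m * norm x"
      by (intro mult_right_mono) (auto simp: m_def)
    then show "norm (A *v x) \<le> m * norm x"
      using C(2)[of A x] by (simp add: ac_simps)
  qed
  define t where "t = c / m\<^sup>2"
  define r where "r = sqrt (1 - c\<^sup>2 / m\<^sup>2)"
  have cm: "c\<^sup>2 / m\<^sup>2 \<le> 1" "c\<^sup>2 / m\<^sup>2 > 0"
    using m c by (auto simp: power_mono)
  show ?thesis
  proof
    show "t > 0" using c m by (simp add: t_def)
    show "0 \<le> r" "r < 1" using cm by (auto simp: r_def)
    fix x
    have "(norm ((mat 1 - t *\<^sub>R A) *v x))\<^sup>2 = (norm (x - t *\<^sub>R (A *v x)))\<^sup>2"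
      by (simp add: matrix_vector_mult_diff_rdistrib scaleR_matrix_vector_assoc)
    also have "\<dots> = (norm x)\<^sup>2 - 2 * t * (x \<bullet> (A *v x)) + t\<^sup>2 * (norm (A *v x))\<^sup>2"
      by (simp only: power2_norm_eq_inner)
        (simp add: inner_diff_left inner_diff_right inner_commute power2_eq_square algebra_simps)
    also have "\<dots> \<le> (norm x)\<^sup>2 - 2 * t * (c * (norm x)\<^sup>2) + t\<^sup>2 * (m * norm x)\<^sup>2"
      using c m \<open>t > 0\<close> by (intro add_mono diff_mono mult_left_mono power_mono) auto
    also have "\<dots> = (1 - c\<^sup>2 / m\<^sup>2) * (norm x)\<^sup>2"
      using m(1) by (simp add: t_def field_simps power2_eq_square)
    also have "\<dots> = (r * norm x)\<^sup>2"
      using cm by (simp add: r_def power_mult_distrib)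
    finally show "norm ((mat 1 - t *\<^sub>R A) *v x) \<le> r * norm x"
      using \<open>0 \<le> r\<close> by (simp add: power2_le_iff_abs_le)
  qed
qed

lemma pos_def_scaleR: "pos_def A \<Longrightarrow> t > 0 \<Longrightarrow> pos_def (t *\<^sub>R A)"
  by (simp add: pos_def_def transpose_scalar scaleR_matrix_vector_assoc[symmetric])

text \<open>After scaling, \<open>A = 1 - X\<close> with \<open>X\<close> a contraction, and \<open>1 - Y\<close> is a square root of \<open>1 - X\<close> exactly
  if \<open>Y = (X + Y\<^sup>2) / 2\<close>. The right-hand side is a contraction on the symmetric matrices with
  operator norm at most \<open>\<rho> < 1\<close>, so Banach's fixed point theorem applies.\<close>

lemma pos_def_sqrt_exists:
  fixes A :: "real^'p::finite^'p"
  assumes A: "pos_def A"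
  shows "\<exists>B. pos_def B \<and> B ** B = A"
proof -
  obtain t r where t: "t > 0" and r: "0 \<le> r" "r < 1"
    and X: "\<And>x. norm ((mat 1 - t *\<^sub>R A) *v x) \<le> r * norm x"
    using pos_def_contraction[OF A] by metis
  define X where "X = mat 1 - t *\<^sub>R A"
  have tX: "transpose X = X"
    using A by (simp add: X_def pos_def_def transpose_def vec_eq_iff mat_def)
  \<comment> \<open>The smaller root of \<open>\<rho>\<^sup>2 - 2 \<rho> + r = 0\<close>: the fixed point equation for the bounds of \<open>X\<close> and \<open>Y\<close>.\<close>
  define \<rho> where "\<rho> = 1 - sqrt (1 - r)"
  have \<rho>: "0 \<le> \<rho>" "\<rho> < 1" and r\<rho>: "(r + \<rho>\<^sup>2) / 2 = \<rho>"
    using r by (auto simp: \<rho>_def power2_diff real_sqrt_le_1_iff)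
  define S where "S = {Y :: real^'p^'p. transpose Y = Y \<and> (\<forall>x. norm (Y *v x) \<le> \<rho> * norm x)}"
  define F where "F Y = (1/2) *\<^sub>R (X + Y ** Y)" for Y
  have "\<exists>!Y\<in>S. F Y = Y"
  proof (rule Banach_fix)
    have "closed S"
    proof -
      have "closed {Y :: real^'p^'p. transpose Y = Y}"
        unfolding transpose_def by (intro closed_Collect_eq continuous_intros)
      moreover have "closed {Y :: real^'p^'p. \<forall>x. norm (Y *v x) \<le> \<rho> * norm x}"
        by (intro closed_Collect_all closed_Collect_le continuous_intros)
      ultimately show ?thesis
        unfolding S_def Collect_conj_eq by (rule closed_Int)
    qed
    then show "uniform_space_class.complete S" by (simp add: complete_eq_closed)
    have "0 \<in> S" using \<rho> by (simp add: S_def transpose_def vec_eq_iff)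
    then show "S \<noteq> {}" by blast
    show "0 \<le> \<rho>" "\<rho> < 1" by fact+
    show "F ` S \<subseteq> S"
    proof (rule image_subsetI)
      fix Y assume Y: "Y \<in> S"
      have "transpose (Y ** Y) = Y ** Y"
        using Y by (simp add: S_def matrix_transpose_mul)
      then have "transpose (F Y) = F Y"
        using tX by (simp add: F_def transpose_def vec_eq_iff)
      moreover have "norm (F Y *v x) \<le> \<rho> * norm x" for x
      proof -
        have "norm (Y *v (Y *v x)) \<le> \<rho> * norm (Y *v x)" using Y by (simp add: S_def)
        also have "\<dots> \<le> \<rho> * (\<rho> * norm x)" using Y \<rho> by (intro mult_left_mono) (auto simp: S_def)
        finally have YY: "norm (Y *v (Y *v x)) \<le> \<rho>\<^sup>2 * norm x" by (simp add: power2_eq_square)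
        have "norm (F Y *v x) = (1/2) * norm (X *v x + Y *v (Y *v x))"
          by (simp add: F_def scaleR_matrix_vector_assoc[symmetric] matrix_vector_mult_add_rdistrib
              matrix_vector_mul_assoc del: scaleR_add_right)
        also have "\<dots> \<le> (1/2) * (r * norm x + \<rho>\<^sup>2 * norm x)"
          using X[of x] YY norm_triangle_ineq[of "X *v x" "Y *v (Y *v x)"] by (simp add: X_def)
        also have "\<dots> = ((r + \<rho>\<^sup>2) / 2) * norm x" by (simp add: field_simps)
        finally show ?thesis by (simp add: r\<rho>)
      qed
      ultimately show "F Y \<in> S" by (simp add: S_def)
    qed
    fix Y Y' assume Y: "Y \<in> S" and Y': "Y' \<in> S"
    let ?D = "Y - Y'"
    have "transpose ?D = ?D"
      using Y Y' by (simp add: S_def transpose_def vec_eq_iff)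
    then have "norm (Y ** ?D) = norm (?D ** Y)"
      using Y norm_transpose[of "Y ** ?D"] by (simp add: S_def matrix_transpose_mul)
    also have "\<dots> \<le> \<rho> * norm ?D"
      using Y \<rho> by (intro norm_mult_symmetric_le) (auto simp: S_def)
    finally have 1: "norm (Y ** ?D) \<le> \<rho> * norm ?D" .
    have 2: "norm (?D ** Y') \<le> \<rho> * norm ?D"
      using Y' \<rho> by (intro norm_mult_symmetric_le) (auto simp: S_def)
    have "dist (F Y) (F Y') = (1/2) * norm (Y ** ?D + ?D ** Y')"
      by (simp add: dist_norm F_def matrix_square_diff[symmetric] scaleR_diff_right[symmetric] del: scaleR_diff_right)
    also have "\<dots> \<le> (1/2) * (norm (Y ** ?D) + norm (?D ** Y'))"
      by (intro mult_left_mono norm_triangle_ineq) simp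
    also have "\<dots> \<le> \<rho> * dist Y Y'"
      using 1 2 by (simp add: dist_norm)
    finally show "dist (F Y) (F Y') \<le> \<rho> * dist Y Y'" .
  qed
  then obtain Y where Y: "Y \<in> S" "F Y = Y" by blast
  let ?B = "mat 1 - Y"
  have "pos_def ?B"
    unfolding pos_def_def
  proof (intro conjI allI impI)
    show "transpose ?B = ?B" using Y(1) by (simp add: S_def transpose_def vec_eq_iff mat_def)
    fix x :: "real^'p" assume "x \<noteq> 0"
    have "x \<bullet> (Y *v x) \<le> norm x * norm (Y *v x)" by (rule norm_cauchy_schwarz)
    also have "\<dots> \<le> norm x * (\<rho> * norm x)" using Y(1) by (intro mult_left_mono) (auto simp: S_def)
    also have "\<dots> < norm x * norm x" using \<rho> \<open>x \<noteq> 0\<close> by simp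
    finally show "0 < x \<bullet> (?B *v x)"
      by (simp add: matrix_vector_mult_diff_rdistrib inner_diff_right power2_norm_eq_inner[symmetric] power2_eq_square)
  qed
  moreover have "?B ** ?B = t *\<^sub>R A"
  proof -
    have "Y ** Y = 2 *\<^sub>R F Y - X"
      by (simp add: F_def)
    then have "Y ** Y = Y + Y - X"
      using Y(2) by (simp add: scaleR_2)
    then show ?thesis
      by (simp add: matrix_mult_diff_left matrix_mult_diff_right X_def)
  qed
  ultimately have "pos_def ((1 / sqrt t) *\<^sub>R ?B)" "((1 / sqrt t) *\<^sub>R ?B) ** ((1 / sqrt t) *\<^sub>R ?B) = A"
    using t by (auto intro!: pos_def_scaleR
        simp: scalar_matrix_assoc[symmetric] matrix_scalar_ac simp del: scaleR_diff_right)
  then show ?thesis by blast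
qed

lemma pos_semidef_sqrt_unique:
  fixes S T :: "real^'p::finite^'p"
  assumes "pos_def S" "pos_semidef T" "S ** S = T ** T"
  shows "S = T"
proof -
  obtain c where c: "c > 0" "\<And>x. c * (norm x)\<^sup>2 \<le> x \<bullet> (S *v x)"
    using assms(1) positive_form_coercive[of S] by (auto simp: pos_def_def)
  have "c * norm (S - T) \<le> 0"
    using norm_diff_le_norm_square_diff[OF _ c(2) assms(2)] assms by (simp add: pos_def_def)
  then show ?thesis using c(1) by (simp add: mult_le_0_iff)
qed

lemma matrix_sqrt_eqI:
  assumes "pos_def B" "B ** B = A"
  shows "matrix_sqrt A = B"
  unfolding matrix_sqrt_def
proof (rule the_equality)
  show "pos_semidef B \<and> B ** B = A"
    using assms pos_def_imp_pos_semidef by blast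
  show "C = B" if "pos_semidef C \<and> C ** C = A" for C
    using pos_semidef_sqrt_unique[OF assms(1), of C] assms(2) that by simp
qed

lemma matrix_sqrt:
  assumes "pos_def A"
  shows "pos_def (matrix_sqrt A)" "matrix_sqrt A ** matrix_sqrt A = A"
proof -
  obtain B where "pos_def B" "B ** B = A"
    using pos_def_sqrt_exists[OF assms] by blast
  moreover from this have "matrix_sqrt A = B"
    by (rule matrix_sqrt_eqI)
  ultimately show "pos_def (matrix_sqrt A)" "matrix_sqrt A ** matrix_sqrt A = A"
    by simp_all
qed

lemma continuous_on_matrix_sqrt:
  "continuous_on {A :: real^'p::finite^'p. pos_def A} matrix_sqrt"
  unfolding continuous_on_iff
proof (intro ballI allI impI)
  fix A :: "real^'p^'p" and e :: real
  assume A: "A \<in> {A. pos_def A}" and e: "e > 0"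
  let ?S = "matrix_sqrt A"
  have S: "pos_def ?S" "?S ** ?S = A" using A matrix_sqrt by auto
  then obtain c where c: "c > 0" "\<And>x. c * (norm x)\<^sup>2 \<le> x \<bullet> (?S *v x)"
    using positive_form_coercive[of ?S] by (auto simp: pos_def_def)
  have "dist (matrix_sqrt B) ?S < e" if B: "pos_def B" "dist B A < c * e" for B
  proof -
    have "c * norm (?S - matrix_sqrt B) \<le> norm (A - B)"
      using norm_diff_le_norm_square_diff[OF _ c(2), of "matrix_sqrt B"] S matrix_sqrt[OF B(1)]
      by (simp add: pos_def_def pos_def_imp_pos_semidef)
    also have "\<dots> < c * e" using B(2) by (simp add: dist_norm norm_minus_commute)
    finally show ?thesis using c(1) by (simp add: dist_norm norm_minus_commute)
  qed
  then show "\<exists>d>0. \<forall>B\<in>{A. pos_def A}. dist B A < d \<longrightarrow> dist (matrix_sqrt B) ?S < e"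
    using c(1) e by (intro exI[of _ "c * e"]) auto
qed

lemma pos_def_mat_1: "pos_def (mat 1 :: real^'p::finite^'p)"
  by (simp add: pos_def_def)

lemma pos_def_matrix_inv:
  fixes A :: "real^'p::finite^'p"
  assumes A: "pos_def A"
  shows "pos_def (matrix_inv A)"
  unfolding pos_def_def
proof (intro conjI allI impI)
  let ?B = "matrix_inv A"
  note AB = matrix_inv_mult[OF A]
  have "A ** transpose ?B = transpose (?B ** A)"
    using A by (simp add: matrix_transpose_mul pos_def_def)
  then show "transpose ?B = ?B"
    using matrix_inv_eqI[OF A, of "transpose ?B"] AB by simp
  fix x :: "real^'p" assume "x \<noteq> 0"
  have x: "A *v (?B *v x) = x" by (simp add: matrix_vector_mul_assoc AB)
  then have "?B *v x \<noteq> 0" using \<open>x \<noteq> 0\<close> by auto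
  then have "0 < (?B *v x) \<bullet> (A *v (?B *v x))" using A by (simp add: pos_def_def)
  then show "0 < x \<bullet> (?B *v x)" by (simp add: x inner_commute)
qed

text \<open>These identities carry the law \<open>N(0, A)\<close> of \<open>A\<^sup>1\<^sup>/\<^sup>2 \<zeta>\<close> to \<open>N(0, A\<^sup>-\<^sup>1)\<close> under
  multiplication by \<open>A\<^sup>-\<^sup>1\<close>, and further to the standard normal law under multiplication by
  \<open>A\<^sup>1\<^sup>/\<^sup>2\<close>.\<close>

lemma matrix_sqrt_matrix_inv:
  fixes A :: "real^'p::finite^'p"
  assumes A: "pos_def A"
  shows "matrix_sqrt (matrix_inv A) = matrix_inv A ** matrix_sqrt A"
    and "matrix_sqrt A ** (matrix_inv A ** matrix_sqrt A) = mat 1"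
proof -
  let ?S = "matrix_sqrt A"
  note S = matrix_sqrt[OF A]
  let ?R = "matrix_inv ?S"
  note SR = matrix_inv_mult[OF S(1)]
  have "A ** (?R ** ?R) = ?S ** (?S ** ?R) ** ?R"
    by (metis S(2) matrix_mul_assoc)
  then have inv: "matrix_inv A = ?R ** ?R"
    by (intro matrix_inv_eqI[OF A]) (simp add: SR)
  then have R: "matrix_inv A ** ?S = ?R"
    by (metis SR(2) matrix_mul_assoc matrix_mul_rid)
  show "matrix_sqrt (matrix_inv A) = matrix_inv A ** ?S"
    unfolding R by (rule matrix_sqrt_eqI[OF pos_def_matrix_inv[OF S(1)] inv[symmetric]])
  show "?S ** (matrix_inv A ** ?S) = mat 1"
    unfolding R by (rule SR)
qed

section \<open>Mapping theorems for convergence in law\<close>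

text \<open>Where \<open>\<phi>\<close> vanishes, \<open>g\<close> may jump, but it is bounded and hence damped by \<open>\<phi>\<close>.\<close>

lemma continuous_on_cutoff_mult:
  fixes \<phi> g :: "'s::topological_space \<Rightarrow> real"
  assumes \<phi>: "continuous_on UNIV \<phi>" and g: "continuous_on {s. \<phi> s \<noteq> 0} g"
    and bound: "\<And>s. \<bar>g s\<bar> \<le> B"
  shows "continuous_on UNIV (\<lambda>s. \<phi> s * g s)"
  unfolding continuous_on_def
proof
  fix s
  have \<phi>s: "(\<phi> \<longlongrightarrow> \<phi> s) (at s)"
    using \<phi> by (auto simp: continuous_on_def)
  show "((\<lambda>s. \<phi> s * g s) \<longlongrightarrow> \<phi> s * g s) (at s within UNIV)"
  proof (cases "\<phi> s = 0")
    case True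
    have "((\<lambda>s. \<bar>\<phi> s\<bar> * B) \<longlongrightarrow> \<bar>\<phi> s\<bar> * B) (at s)"
      by (intro tendsto_intros \<phi>s)
    then have "((\<lambda>s. \<bar>\<phi> s\<bar> * B) \<longlongrightarrow> 0) (at s)"
      using True by simp
    moreover
    have "norm (\<phi> s * g s) \<le> \<bar>\<phi> s\<bar> * B" for s
      by (simp add: abs_mult mult_left_mono bound)
    then have "eventually (\<lambda>s. norm (\<phi> s * g s) \<le> \<bar>\<phi> s\<bar> * B) (at s)"
      by (rule always_eventually[OF allI])
    ultimately have "((\<lambda>s. \<phi> s * g s) \<longlongrightarrow> 0) (at s)"
      by (rule Lim_null_comparison[rotated])
    then show ?thesis using True by simp
  next
    case False
    have "open {s. \<phi> s \<noteq> 0}"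
      by (intro open_Collect_neq \<phi> continuous_on_const)
    then have "at s within {s. \<phi> s \<noteq> 0} = at s"
      using False by (intro at_within_open) auto
    then have "(g \<longlongrightarrow> g s) (at s)"
      using g False by (auto simp: continuous_on_def)
    then show ?thesis using \<phi>s by (simp add: tendsto_mult)
  qed
qed

text \<open>The continuous mapping theorem for a map with discontinuities that the limit avoids. The cutoff \<open>\<phi>\<close>,
  which equals 1 almost surely in the limit and vanishes wherever \<open>h\<close> is not known to be continuous,
  turns \<open>f \<circ> h\<close> into the continuous test function \<open>\<phi> \<cdot> (f \<circ> h)\<close>. The error made in the
  \<open>n\<close>-th expectation is at most \<open>sup \<bar>f\<bar> \<cdot> (1 - E \<phi>(X\<^sub>n))\<close>, which tends to 0 because \<open>\<phi>\<close> is
  itself a test function. The cutoff replaces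
  the approximation of open sets from inside by continuous functions that a metric would provide.\<close>

lemma converges_in_law_mapping:
  fixes X :: "nat \<Rightarrow> 'a \<Rightarrow> 's::topological_space" and h :: "'s \<Rightarrow> 't::topological_space"
  assumes conv: "converges_in_law M X N Y"
    and \<phi>: "continuous_on UNIV \<phi>" "\<And>s. 0 \<le> \<phi> s" "\<And>s. \<phi> s \<le> (1::real)"
    and AE: "AE \<omega> in N. \<phi> (Y \<omega>) = 1"
    and h: "h \<in> borel_measurable borel" "continuous_on {s. \<phi> s \<noteq> 0} h"
  shows "converges_in_law M (\<lambda>n \<omega>. h (X n \<omega>)) N (\<lambda>\<omega>. h (Y \<omega>))"
proof -
  have M: "prob_space (M n)" and X [measurable]: "X n \<in> borel_measurable (M n)" for n
    using conv by (auto simp: converges_in_law_def)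
  have N: "prob_space N" and Y [measurable]: "Y \<in> borel_measurable N"
    using conv by (auto simp: converges_in_law_def)
  interpret N: prob_space N by fact
  have lim: "(\<lambda>n. \<integral>\<omega>. g (X n \<omega>) \<partial>M n) \<longlonglongrightarrow> (\<integral>\<omega>. g (Y \<omega>) \<partial>N)"
    if "continuous_on UNIV g" "\<And>s. \<bar>g s\<bar> \<le> B" for g :: "'s \<Rightarrow> real" and B
  proof -
    have "bounded (range g)" using that(2) by (auto simp: bounded_iff)
    then show ?thesis using conv that(1) by (simp add: converges_in_law_def)
  qed
  have [measurable]: "\<phi> \<in> borel_measurable borel" "h \<in> borel_measurable borel"
    using \<phi>(1) h(1) by (auto intro: borel_measurable_continuous_onI)
  have "(\<lambda>n. \<integral>\<omega>. f (h (X n \<omega>)) \<partial>M n) \<longlonglongrightarrow> (\<integral>\<omega>. f (h (Y \<omega>)) \<partial>N)"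
    if f: "continuous_on UNIV f" and "bounded (range f)" for f :: "'t \<Rightarrow> real"
  proof -
    obtain B where B: "\<And>t. \<bar>f t\<bar> \<le> B"
      using \<open>bounded (range f)\<close> by (auto simp: bounded_iff)
    have [measurable]: "f \<in> borel_measurable borel"
      using f by (rule borel_measurable_continuous_onI)
    define g where "g s = \<phi> s * f (h s)" for s
    have gB: "\<bar>g s\<bar> \<le> B" for s
    proof -
      have "\<bar>g s\<bar> \<le> 1 * B"
        unfolding g_def abs_mult using \<phi>(2,3)[of s] B[of "h s"] by (intro mult_mono) auto
      then show ?thesis by simp
    qed
    have "continuous_on UNIV g"
      unfolding g_def
      by (intro continuous_on_cutoff_mult[OF \<phi>(1), of _ B] B continuous_on_compose2[OF f h(2)]) auto
    from lim[OF this gB] have "(\<lambda>n. \<integral>\<omega>. g (X n \<omega>) \<partial>M n) \<longlonglongrightarrow> (\<integral>\<omega>. g (Y \<omega>) \<partial>N)" .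
    also have "(\<integral>\<omega>. g (Y \<omega>) \<partial>N) = (\<integral>\<omega>. f (h (Y \<omega>)) \<partial>N)"
      using AE by (intro integral_cong_AE) (auto simp: g_def)
    finally have 1: "(\<lambda>n. \<integral>\<omega>. g (X n \<omega>) \<partial>M n) \<longlonglongrightarrow> (\<integral>\<omega>. f (h (Y \<omega>)) \<partial>N)" .
    have "(\<lambda>n. \<integral>\<omega>. \<phi> (X n \<omega>) \<partial>M n) \<longlonglongrightarrow> (\<integral>\<omega>. \<phi> (Y \<omega>) \<partial>N)"
      using \<phi> by (intro lim[of \<phi> 1]) (simp_all add: abs_of_nonneg)
    also have "(\<integral>\<omega>. \<phi> (Y \<omega>) \<partial>N) = (\<integral>\<omega>. 1 \<partial>N)"
      using AE by (intro integral_cong_AE) auto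
    also have "\<dots> = 1" by (simp add: N.prob_space)
    finally have "(\<lambda>n. B * (1 - (\<integral>\<omega>. \<phi> (X n \<omega>) \<partial>M n))) \<longlonglongrightarrow> B * (1 - 1)"
      by (rule tendsto_mult[OF tendsto_const tendsto_diff[OF tendsto_const]])
    then have "(\<lambda>n. B * (1 - (\<integral>\<omega>. \<phi> (X n \<omega>) \<partial>M n))) \<longlonglongrightarrow> 0" by simp
    moreover have "norm ((\<integral>\<omega>. f (h (X n \<omega>)) \<partial>M n) - (\<integral>\<omega>. g (X n \<omega>) \<partial>M n))
        \<le> B * (1 - (\<integral>\<omega>. \<phi> (X n \<omega>) \<partial>M n))" for n
    proof -
      interpret M: prob_space "M n" by (rule M)
      have int: "integrable (M n) (\<lambda>\<omega>. f (h (X n \<omega>)))" "integrable (M n) (\<lambda>\<omega>. g (X n \<omega>))"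
        "integrable (M n) (\<lambda>\<omega>. \<phi> (X n \<omega>))"
      proof -
        have [measurable]: "g \<in> borel_measurable borel"
          unfolding g_def by measurable
        show "integrable (M n) (\<lambda>\<omega>. f (h (X n \<omega>)))"
          by (rule M.integrable_const_bound[where B = B]) (simp_all add: B)
        show "integrable (M n) (\<lambda>\<omega>. g (X n \<omega>))"
          by (rule M.integrable_const_bound[where B = B]) (simp_all add: gB)
        show "integrable (M n) (\<lambda>\<omega>. \<phi> (X n \<omega>))"
          by (rule M.integrable_const_bound[where B = 1]) (simp_all add: \<phi>)
      qed
      have "norm (\<integral>\<omega>. f (h (X n \<omega>)) - g (X n \<omega>) \<partial>M n) \<le> (\<integral>\<omega>. B * (1 - \<phi> (X n \<omega>)) \<partial>M n)"
      proof (rule order_trans[OF integral_norm_bound integral_mono])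
        fix \<omega>
        show "norm (f (h (X n \<omega>)) - g (X n \<omega>)) \<le> B * (1 - \<phi> (X n \<omega>))"
        proof -
          have "norm (f (h (X n \<omega>)) - g (X n \<omega>)) = \<bar>f (h (X n \<omega>))\<bar> * (1 - \<phi> (X n \<omega>))"
          proof -
            have "f (h (X n \<omega>)) - g (X n \<omega>) = f (h (X n \<omega>)) * (1 - \<phi> (X n \<omega>))"
              by (simp add: g_def algebra_simps)
            then show ?thesis
              using \<phi>(3)[of "X n \<omega>"] by (simp add: abs_mult)
          qed
          also have "\<dots> \<le> B * (1 - \<phi> (X n \<omega>))"
            using \<phi>(3)[of "X n \<omega>"] B by (intro mult_right_mono) auto
          finally show ?thesis .
        qed
        show "integrable (M n) (\<lambda>\<omega>. norm (f (h (X n \<omega>)) - g (X n \<omega>)))"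
          by (intro integrable_norm Bochner_Integration.integrable_diff int)
        show "integrable (M n) (\<lambda>\<omega>. B * (1 - \<phi> (X n \<omega>)))"
          by (intro integrable_mult_right Bochner_Integration.integrable_diff int M.integrable_const)
      qed
      also have "(\<integral>\<omega>. B * (1 - \<phi> (X n \<omega>)) \<partial>M n) = B * (1 - (\<integral>\<omega>. \<phi> (X n \<omega>) \<partial>M n))"
        by (simp add: Bochner_Integration.integral_diff int M.prob_space)
      finally show ?thesis
        by (simp only: Bochner_Integration.integral_diff[OF int(1,2)])
    qed
    ultimately have "(\<lambda>n. (\<integral>\<omega>. f (h (X n \<omega>)) \<partial>M n) - (\<integral>\<omega>. g (X n \<omega>) \<partial>M n)) \<longlonglongrightarrow> 0"
      by (rule Lim_null_comparison[OF always_eventually[OF allI], rotated])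
    from tendsto_add[OF this 1] show ?thesis by simp
  qed
  then show ?thesis
    using M N by (simp add: converges_in_law_def)
qed

lemma converges_in_law_compose:
  assumes "converges_in_law M X N Y" "continuous_on UNIV g"
  shows "converges_in_law M (\<lambda>n \<omega>. g (X n \<omega>)) N (\<lambda>\<omega>. g (Y \<omega>))"
  using assms(2)
  by (intro converges_in_law_mapping[OF assms(1), of "\<lambda>_. 1"]) (auto intro: borel_measurable_continuous_onI)

lemma converges_in_law_AE_cong:
  fixes Y Y' :: "'b \<Rightarrow> 's::topological_space"
  assumes "converges_in_law M X N Y" "Y' \<in> borel_measurable N" "AE \<omega> in N. Y \<omega> = Y' \<omega>"
  shows "converges_in_law M X N Y'"
  unfolding converges_in_law_def
proof (intro conjI allI impI)
  fix f :: "'s \<Rightarrow> real"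
  assume f: "continuous_on UNIV f" "bounded (range f)"
  have [measurable]: "f \<in> borel_measurable borel"
    using f(1) by (rule borel_measurable_continuous_onI)
  have [measurable]: "Y \<in> borel_measurable N" "Y' \<in> borel_measurable N"
    using assms by (auto simp: converges_in_law_def)
  have "(\<integral>\<omega>. f (Y \<omega>) \<partial>N) = (\<integral>\<omega>. f (Y' \<omega>) \<partial>N)"
    using assms(3) by (intro integral_cong_AE) auto
  moreover have "(\<lambda>n. \<integral>\<omega>. f (X n \<omega>) \<partial>M n) \<longlonglongrightarrow> (\<integral>\<omega>. f (Y \<omega>) \<partial>N)"
    using assms(1) f by (simp add: converges_in_law_def)
  ultimately show "(\<lambda>n. \<integral>\<omega>. f (X n \<omega>) \<partial>M n) \<longlonglongrightarrow> (\<integral>\<omega>. f (Y' \<omega>) \<partial>N)"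
    by simp
qed (use assms in \<open>auto simp: converges_in_law_def\<close>)

text \<open>Convergence to \<open>g(V)\<close> as convergence to \<open>g\<close> on the space that carries the law of \<open>V\<close>.\<close>

lemma converges_in_law_distr:
  fixes V :: "'b \<Rightarrow> 't::topological_space" and g :: "'t \<Rightarrow> 's::topological_space"
  assumes conv: "converges_in_law M X N (\<lambda>\<omega>. g (V \<omega>))" and V: "V \<in> borel_measurable N"
    and g: "continuous_on UNIV g"
  shows "converges_in_law M X (distr N borel V) g"
  unfolding converges_in_law_def
proof (intro conjI allI impI)
  have [measurable]: "g \<in> borel_measurable borel"
    using g by (rule borel_measurable_continuous_onI)
  note [measurable] = V
  show "prob_space (distr N borel V)"
    using conv by (intro prob_space.prob_space_distr) (auto simp: converges_in_law_def)
  show "g \<in> borel_measurable (distr N borel V)" by simp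
  fix f :: "'s \<Rightarrow> real"
  assume f: "continuous_on UNIV f" "bounded (range f)"
  have [measurable]: "f \<in> borel_measurable borel"
    using f(1) by (rule borel_measurable_continuous_onI)
  have "(\<integral>x. f (g x) \<partial>distr N borel V) = (\<integral>\<omega>. f (g (V \<omega>)) \<partial>N)"
    by (rule integral_distr) measurable
  then show "(\<lambda>n. \<integral>\<omega>. f (X n \<omega>) \<partial>M n) \<longlonglongrightarrow> (\<integral>x. f (g x) \<partial>distr N borel V)"
    using conv f by (simp add: converges_in_law_def)
qed (use conv in \<open>auto simp: converges_in_law_def\<close>)

lemma continuous_on_Some:
  fixes f :: "'s::topological_space \<Rightarrow> 't::topological_space"
  assumes "continuous_on S f"
  shows "continuous_on S (\<lambda>x. Some (f x))"
proof (rule continuous_on_compose2[OF _ assms])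
  show "continuous_on UNIV (Some :: 't \<Rightarrow> 't option)"
    by (simp add: continuous_on_open_vimage open_option_def)
qed simp

section \<open>The Newton step as a function of log likelihood and starting point\<close>

definition newton_point :: "'p::finite c2 \<times> (real^'p) \<Rightarrow> real^'p" where
  "newton_point z = snd z + matrix_inv (neg_hess (fst z) (snd z)) *v grad (c2_fun (fst z)) (snd z)"

text \<open>The tuple of the joint convergence in law, as one function to which the mapping theorem can be applied.\<close>

definition newton_statistics :: "'p::finite c2 \<times> (real^'p) \<Rightarrow>
    'p c2 \<times> (real^'p) \<times> (real^'p^'p) \<times> (real^'p^'p) option \<times> (real^'p) option \<times> (real^'p) option" where
  "newton_statistics z =
     (let d = newton_step (fst z) (Some (snd z)); A = map_option (neg_hess (fst z)) d
      in (fst z, snd z, neg_hess (fst z) (snd z), A, d, nao_mult_vec (nao_sqrt A) d))"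

definition newton_domain :: "('p::finite c2 \<times> (real^'p)) set" where
  "newton_domain = {z. pos_def (neg_hess (fst z) (snd z))}"

text \<open>The region in which no component of \<open>newton_statistics\<close> is NaO.\<close>

definition newton_regular :: "('p::finite c2 \<times> (real^'p)) set" where
  "newton_regular = {z \<in> newton_domain. pos_def (neg_hess (fst z) (newton_point z))}"

lemma pos_def_neg_hess_iff:
  "pos_def (neg_hess q x) \<longleftrightarrow> neg_hess q x \<in> {A. \<forall>v. v \<noteq> 0 \<longrightarrow> 0 < v \<bullet> (A *v v)}"
  by (simp add: pos_def_def transpose_neg_hess)

lemma open_newton_domain: "open (newton_domain :: ('p::finite c2 \<times> (real^'p)) set)"
proof -
  have eq: "(newton_domain :: ('p c2 \<times> (real^'p)) set) = (\<lambda>z. neg_hess (fst z) (snd z)) -` {A. \<forall>v. v \<noteq> 0 \<longrightarrow> 0 < v \<bullet> (A *v v)}"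
    unfolding newton_domain_def pos_def_neg_hess_iff by auto
  show ?thesis
    unfolding eq by (rule open_vimage[OF open_positive_matrices continuous_on_neg_hess])
qed

lemma continuous_on_newton_point: "continuous_on newton_domain newton_point"
  unfolding newton_point_def
  by (intro continuous_intros continuous_on_matrix_inv_mult
      continuous_on_subset[OF continuous_on_neg_hess] continuous_on_subset[OF continuous_on_grad_c2])
    (auto simp: newton_domain_def)

lemma continuous_on_neg_hess_newton_point:
  "continuous_on newton_domain (\<lambda>z. neg_hess (fst z) (newton_point z))"
proof -
  have "continuous_on newton_domain (\<lambda>z. (fst z, newton_point z))"
    by (intro continuous_intros continuous_on_newton_point)
  from continuous_on_compose2[OF continuous_on_neg_hess this] show ?thesis by simp
qed

lemma open_newton_regular: "open (newton_regular :: ('p::finite c2 \<times> (real^'p)) set)"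
proof -
  have eq: "(newton_regular :: ('p c2 \<times> (real^'p)) set) = (\<lambda>z. neg_hess (fst z) (newton_point z)) -` {A. \<forall>v. v \<noteq> 0 \<longrightarrow> 0 < v \<bullet> (A *v v)}
      \<inter> newton_domain"
    unfolding newton_regular_def pos_def_neg_hess_iff by auto
  show ?thesis
    unfolding eq
    by (rule continuous_on_open_vimage[THEN iffD1, OF open_newton_domain continuous_on_neg_hess_newton_point,
        rule_format, OF open_positive_matrices])
qed

lemma newton_statistics_regular:
  assumes "z \<in> newton_regular"
  shows "newton_statistics z = (fst z, snd z, neg_hess (fst z) (snd z), Some (neg_hess (fst z) (newton_point z)),
    Some (newton_point z), Some (matrix_sqrt (neg_hess (fst z) (newton_point z)) *v newton_point z))"
  using assms
  by (simp add: newton_statistics_def newton_regular_def newton_domain_def newton_step_def newton_point_def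
      nao_mult_vec_def nao_sqrt_def Let_def)

lemma newton_statistics_irregular:
  assumes "z \<in> newton_domain - newton_regular"
  shows "newton_statistics z = (fst z, snd z, neg_hess (fst z) (snd z), Some (neg_hess (fst z) (newton_point z)),
    Some (newton_point z), NaO)"
  using assms
  by (simp add: newton_statistics_def newton_regular_def newton_domain_def newton_step_def newton_point_def
      nao_mult_vec_def nao_sqrt_def Let_def)

lemma newton_statistics_undefined:
  assumes "z \<in> - newton_domain"
  shows "newton_statistics z = (fst z, snd z, neg_hess (fst z) (snd z), NaO, NaO, NaO)"
  using assms
  by (simp add: newton_statistics_def newton_domain_def newton_step_def nao_mult_vec_def nao_sqrt_def Let_def)

lemma continuous_on_newton_statistics: "continuous_on newton_regular newton_statistics"
proof -
  have sub: "newton_regular \<subseteq> newton_domain"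
    by (auto simp: newton_regular_def)
  note nh = continuous_on_subset[OF continuous_on_neg_hess_newton_point sub]
    and np = continuous_on_subset[OF continuous_on_newton_point sub]
  have "continuous_on newton_regular (\<lambda>z. matrix_sqrt (neg_hess (fst z) (newton_point z)))"
    by (rule continuous_on_compose2[OF continuous_on_matrix_sqrt nh]) (auto simp: newton_regular_def)
  then have "continuous_on newton_regular (\<lambda>z. (fst z, snd z, neg_hess (fst z) (snd z),
      Some (neg_hess (fst z) (newton_point z)), Some (newton_point z),
      Some (matrix_sqrt (neg_hess (fst z) (newton_point z)) *v newton_point z)))"
    by (intro continuous_intros continuous_on_Some nh np continuous_on_subset[OF continuous_on_neg_hess]) auto
  then show ?thesis
    by (rule continuous_on_eq) (simp add: newton_statistics_regular)
qed

text \<open>The statistics jump only between three Borel regions, distinguished by which components are NaO; on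
  each of them they are continuous.\<close>

lemma borel_measurable_newton_statistics:
  "(newton_statistics :: 'a::finite c2 \<times> (real^'a) \<Rightarrow> _) \<in> borel_measurable borel"
proof (rule measurable_piecewise_restrict[of "{newton_regular, newton_domain - newton_regular, - newton_domain}"])
  have sets: "(newton_domain :: ('a c2 \<times> (real^'a)) set) \<in> sets borel"
      "(newton_regular :: ('a c2 \<times> (real^'a)) set) \<in> sets borel"
    by (rule borel_open open_newton_domain open_newton_regular)+
  show "\<Omega> \<inter> space borel \<in> sets borel"
    if "\<Omega> \<in> {newton_regular, newton_domain - newton_regular, - newton_domain}" for \<Omega> :: "('a c2 \<times> (real^'a)) set"
    using that sets by (auto intro: borel_comp)
  show "newton_statistics \<in> borel_measurable (restrict_space borel \<Omega>)"
    if "\<Omega> \<in> {newton_regular, newton_domain - newton_regular, - newton_domain}" for \<Omega> :: "('a c2 \<times> (real^'a)) set"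
  proof (rule borel_measurable_continuous_on_restrict)
    have "continuous_on (newton_domain - newton_regular) (\<lambda>z. (fst z, snd z, neg_hess (fst z) (snd z),
        Some (neg_hess (fst z) (newton_point z)), Some (newton_point z), NaO :: (real^'a) option))"
      by (intro continuous_intros continuous_on_Some continuous_on_subset[OF continuous_on_neg_hess_newton_point]
          continuous_on_subset[OF continuous_on_newton_point] continuous_on_subset[OF continuous_on_neg_hess]) auto
    then have "continuous_on (newton_domain - newton_regular :: ('a c2 \<times> (real^'a)) set) newton_statistics"
      by (rule continuous_on_eq) (simp add: newton_statistics_irregular)
    moreover have "continuous_on (- newton_domain) (\<lambda>z :: 'a c2 \<times> (real^'a). (fst z, snd z, neg_hess (fst z) (snd z),
        NaO :: (real^'a^'a) option, NaO :: (real^'a) option, NaO :: (real^'a) option))"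
      by (intro continuous_intros continuous_on_subset[OF continuous_on_neg_hess]) auto
    then have "continuous_on (- newton_domain :: ('a c2 \<times> (real^'a)) set) newton_statistics"
      by (rule continuous_on_eq) (simp add: newton_statistics_undefined)
    ultimately show "continuous_on \<Omega> newton_statistics"
      using that continuous_on_newton_statistics by auto
  qed
qed auto

text \<open>A tent function of the distance from \<open>K\<close>, supported in a ball of matrices with positive quadratic form,
  is applied to the observed information at the starting point and to that at the Newton point, and
  the results are multiplied. The second factor is continuous only where the Newton step is defined;
  outside this region the first factor vanishes.\<close>

lemma newton_cutoff_exists:
  fixes K :: "real^'p::finite^'p"
  assumes K: "pos_def K"
  obtains \<phi> :: "'p c2 \<times> (real^'p) \<Rightarrow> real" where
    "continuous_on UNIV \<phi>" "\<And>z. 0 \<le> \<phi> z" "\<And>z. \<phi> z \<le> 1" "{z. \<phi> z \<noteq> 0} \<subseteq> newton_regular"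
    "\<And>z. neg_hess (fst z) (snd z) = K \<Longrightarrow> neg_hess (fst z) (newton_point z) = K \<Longrightarrow> \<phi> z = 1"
proof -
  let ?P = "{A :: real^'p^'p. \<forall>v. v \<noteq> 0 \<longrightarrow> 0 < v \<bullet> (A *v v)}"
  have "K \<in> ?P" using K by (simp add: pos_def_def)
  then obtain e where e: "e > 0" "ball K e \<subseteq> ?P"
    using open_contains_ball[THEN iffD1, OF open_positive_matrices, rule_format, of K] by blast
  define b where "b A = max 0 (1 - dist A K / e)" for A :: "real^'p^'p"
  have b: "0 \<le> b A" "b A \<le> 1" "b K = 1" for A
    using e by (auto simp: b_def)
  have bP: "A \<in> ?P" if "b A \<noteq> 0" for A
  proof -
    have "1 - dist A K / e > 0" using that unfolding b_def by linarith
    then have "A \<in> ball K e" using e by (simp add: dist_commute)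
    then show ?thesis using e by blast
  qed
  have cont_b: "continuous_on UNIV b"
    unfolding b_def using e by (intro continuous_intros) auto
  define b1 b2 :: "'p c2 \<times> (real^'p) \<Rightarrow> real"
    where "b1 z = b (neg_hess (fst z) (snd z))" and "b2 z = b (neg_hess (fst z) (newton_point z))" for z
  have sub: "{z. b1 z \<noteq> 0} \<subseteq> newton_domain"
    using bP unfolding b1_def newton_domain_def pos_def_neg_hess_iff by blast
  show ?thesis
  proof
    show "continuous_on UNIV (\<lambda>z. b1 z * b2 z)"
    proof (rule continuous_on_cutoff_mult[of _ _ 1])
      show "continuous_on UNIV b1"
        unfolding b1_def by (rule continuous_on_compose2[OF cont_b continuous_on_neg_hess]) simp
      show "continuous_on {z. b1 z \<noteq> 0} b2"
        unfolding b2_def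
        by (rule continuous_on_compose2[OF cont_b continuous_on_subset[OF continuous_on_neg_hess_newton_point sub]]) simp
      show "\<bar>b2 z\<bar> \<le> 1" for z using b by (simp add: b2_def)
    qed
    show "0 \<le> b1 z * b2 z" "b1 z * b2 z \<le> 1" for z
      using b by (auto simp: b1_def b2_def intro: mult_le_one)
    show "{z. b1 z * b2 z \<noteq> 0} \<subseteq> newton_regular"
      using sub bP unfolding newton_regular_def b2_def pos_def_neg_hess_iff by auto
    show "b1 z * b2 z = 1" if "neg_hess (fst z) (snd z) = K" "neg_hess (fst z) (newton_point z) = K" for z
      using that b by (simp add: b1_def b2_def)
  qed
qed

section \<open>The quadratic limit model\<close>

lemma quadratic_derivatives:
  fixes q :: "'p::finite c2"
  assumes K: "transpose K = K" and q: "\<And>x. c2_fun q x = x \<bullet> z - (1/2) * (x \<bullet> (K *v x))"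
  shows "grad (c2_fun q) x = z - K *v x" and "neg_hess q x = K"
proof -
  have lin: "bounded_linear ((*v) K)"
    by (simp add: linear_linear)
  have sym: "u \<bullet> (K *v v) = v \<bullet> (K *v u)" for u v
    by (metis K dot_lmul_matrix inner_commute transpose_matrix_vector)
  have q': "c2_fun q = (\<lambda>x. x \<bullet> z - (1/2) * (x \<bullet> (K *v x)))"
    using q by blast
  have g: "grad (c2_fun q) x = z - K *v x" for x
  proof (rule grad_eqI)
    have "((\<lambda>x. x \<bullet> z - (1/2) * (x \<bullet> (K *v x))) has_derivative
        (\<lambda>h. h \<bullet> z - (1/2) * (x \<bullet> (K *v h) + h \<bullet> (K *v x)))) (at x)"
      by (intro has_derivative_diff has_derivative_mult_right has_derivative_inner_left
          has_derivative_inner has_derivative_ident bounded_linear.has_derivative[OF lin])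
    then show "(c2_fun q has_derivative (\<lambda>h. (z - K *v x) \<bullet> h)) (at x)"
      unfolding q'
      by (rule has_derivative_eq_rhs) (simp add: fun_eq_iff inner_diff_left inner_diff_right inner_commute sym[of x])
  qed
  then show "grad (c2_fun q) x = z - K *v x" .
  have g': "grad (c2_fun q) = (\<lambda>x. z - K *v x)" using g by blast
  have "((\<lambda>x. z - K *v x) has_derivative (\<lambda>h. 0 - K *v h)) (at x)"
    by (intro has_derivative_diff has_derivative_const bounded_linear_imp_has_derivative[OF lin])
  then have "hess (c2_fun q) x = - K"
    by (intro hess_eqI) (simp add: g' matrix_vector_mult_minus_left)
  then show "neg_hess q x = K" by (simp add: neg_hess_def)
qed

text \<open>For a quadratic log likelihood the Newton step reaches the maximum from any starting point.\<close>

lemma newton_point_quadratic: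
  fixes q :: "'p::finite c2"
  assumes K: "pos_def K" and q: "\<And>x. c2_fun q x = x \<bullet> z - (1/2) * (x \<bullet> (K *v x))"
  shows "newton_point (q, d) = matrix_inv K *v z"
proof -
  have "transpose K = K" using K by (simp add: pos_def_def)
  from quadratic_derivatives[OF this q] show ?thesis
    by (simp add: newton_point_def matrix_vector_mult_diff_distrib matrix_vector_mul_assoc matrix_inv_mult[OF K])
qed

text \<open>With constant information the conditional law of \<open>Z\<close> given \<open>K\<close> is the unconditional one.\<close>

lemma lamn_constant_information_law:
  fixes Z :: "'y \<Rightarrow> real^'p::finite"
  assumes "lamn_model \<nu> f Z (\<lambda>_. K)"
  shows "distr (model_law \<nu> f 0) borel Z = mv_normal 0 K"
proof (rule measure_eqI)
  have Z: "Z \<in> borel_measurable \<nu>" and "prob_space (model_law \<nu> f 0)"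
    and law: "\<And>A B. A \<in> sets borel \<Longrightarrow> B \<in> sets borel \<Longrightarrow>
        emeasure (model_law \<nu> f 0) {x \<in> space \<nu>. K \<in> B \<and> Z x \<in> A} =
        (\<integral>\<^sup>+x. indicator B K * emeasure (mv_normal (K *v 0) K) A \<partial>model_law \<nu> f 0)"
    using assms unfolding lamn_model_def parametric_model_def by auto
  then interpret prob_space "model_law \<nu> f 0" by simp
  show "sets (distr (model_law \<nu> f 0) borel Z) = sets (mv_normal 0 K)"
    by (simp add: mv_normal_def)
  fix A assume "A \<in> sets (distr (model_law \<nu> f 0) borel Z)"
  then have A: "A \<in> sets borel" by simp
  have "emeasure (distr (model_law \<nu> f 0) borel Z) A = emeasure (model_law \<nu> f 0) {x \<in> space \<nu>. K \<in> UNIV \<and> Z x \<in> A}"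
    using Z A by (simp add: emeasure_distr vimage_def Collect_conj_eq Int_commute)
  also have "\<dots> = emeasure (mv_normal 0 K) A"
    using emeasure_space_1 by (subst law[OF A]) simp_all
  finally show "emeasure (distr (model_law \<nu> f 0) borel Z) A = emeasure (mv_normal 0 K) A" .
qed

lemma distr_mv_normal_linear:
  fixes B S T :: "real^'p::finite^'p"
  assumes "B ** matrix_sqrt S = matrix_sqrt T"
  shows "distr (mv_normal 0 S) borel ((*v) B) = mv_normal 0 T"
proof -
  have mult [measurable]: "(*v) C \<in> borel_measurable borel" for C :: "real^'p^'p"
    by (intro borel_measurable_continuous_onI continuous_intros)
  have [simp]: "sets std_mv_normal = sets borel" "space std_mv_normal = UNIV"
    by (simp_all add: std_mv_normal_def)
  have "(\<lambda>z. 0 + matrix_sqrt S *v z) \<in> measurable std_mv_normal borel"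
    using mult by (simp add: measurable_cong_sets[of std_mv_normal borel])
  then show ?thesis
    unfolding mv_normal_def
    by (subst distr_distr) (simp_all add: o_def matrix_vector_mul_assoc assms)
qed

section \<open>Asymptotics of the one-step Newton estimator\<close>

theorem corollary4p4:
  fixes M :: "nat \<Rightarrow> 'w measure"
    and q\<^sub>n :: "nat \<Rightarrow> 'w \<Rightarrow> 'p::finite c2"
    and \<delta>tilde\<^sub>n :: "nat \<Rightarrow> 'w \<Rightarrow> real^'p"
    and \<nu>\<^sub>n :: "nat \<Rightarrow> 'x measure"
    and f\<^sub>n :: "nat \<Rightarrow> real^'p \<Rightarrow> 'x \<Rightarrow> real"
    and X\<^sub>n :: "nat \<Rightarrow> 'w \<Rightarrow> 'x"
    and N :: "'v measure"
    and q :: "'v \<Rightarrow> 'p c2"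
    and \<delta>tilde :: "'v \<Rightarrow> real^'p"
    and \<nu> :: "'y measure"
    and f :: "real^'p \<Rightarrow> 'y \<Rightarrow> real"
    and X :: "'v \<Rightarrow> 'y"
    and Z :: "'y \<Rightarrow> real^'p"
    and K :: "real^'p^'p"
  assumes loglik_n: "\<And>n. log_likelihood (M n) (q\<^sub>n n) (\<nu>\<^sub>n n) (f\<^sub>n n) (X\<^sub>n n) 0"
    and delta_n: "\<And>n. \<delta>tilde\<^sub>n n \<in> borel_measurable (M n)"
    and delta: "\<delta>tilde \<in> borel_measurable N"
    and conv: "converges_in_law M (\<lambda>n \<omega>. (q\<^sub>n n \<omega>, \<delta>tilde\<^sub>n n \<omega>)) N (\<lambda>\<omega>. (q \<omega>, \<delta>tilde \<omega>))"
    and K: "pos_def K"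
    and lamn: "lamn_model \<nu> f Z (\<lambda>_. K)"
    and loglik: "log_likelihood N q \<nu> f X 0"
    and q: "AE \<omega> in N. \<forall>\<delta>. c2_fun (q \<omega>) \<delta> = \<delta> \<bullet> Z (X \<omega>) - (1/2) * (\<delta> \<bullet> (K *v \<delta>))"
  defines "\<delta>hat\<^sub>n \<equiv> \<lambda>n \<omega>. newton_step (q\<^sub>n n \<omega>) (Some (\<delta>tilde\<^sub>n n \<omega>))"
  defines "Ktilde\<^sub>n \<equiv> \<lambda>n \<omega>. neg_hess (q\<^sub>n n \<omega>) (\<delta>tilde\<^sub>n n \<omega>)"
  defines "Khat\<^sub>n \<equiv> \<lambda>n \<omega>. map_option (neg_hess (q\<^sub>n n \<omega>)) (\<delta>hat\<^sub>n n \<omega>)"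
  defines "What\<^sub>n \<equiv> \<lambda>n \<omega>. nao_mult_vec (nao_sqrt (Khat\<^sub>n n \<omega>)) (\<delta>hat\<^sub>n n \<omega>)"
  shows "converges_in_law M Ktilde\<^sub>n N (\<lambda>_. K)
    \<and> converges_in_law M Khat\<^sub>n N (\<lambda>_. Some K)
    \<and> converges_in_law M \<delta>hat\<^sub>n (mv_normal 0 (matrix_inv K)) Some
    \<and> converges_in_law M What\<^sub>n (mv_normal 0 (mat 1)) Some
    \<and> (\<exists>V W. V \<in> borel_measurable N \<and> W \<in> borel_measurable N
         \<and> distr N borel V = mv_normal 0 (matrix_inv K)
         \<and> distr N borel W = mv_normal 0 (mat 1)
         \<and> converges_in_law M
              (\<lambda>n \<omega>. (q\<^sub>n n \<omega>, \<delta>tilde\<^sub>n n \<omega>, Ktilde\<^sub>n n \<omega>, Khat\<^sub>n n \<omega>, \<delta>hat\<^sub>n n \<omega>, What\<^sub>n n \<omega>))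
              N
              (\<lambda>\<omega>. (q \<omega>, \<delta>tilde \<omega>, K, Some K, Some (V \<omega>), Some (W \<omega>))))"
proof -
  let ?A = "matrix_inv K" and ?S = "matrix_sqrt K"
  \<comment> \<open>As \<open>Z\<close> is the gradient of \<open>q\<close> at 0, this is almost surely \<open>K\<^sup>-\<^sup>1 Z\<close>. Being a continuous function of \<open>q\<close>,
    it is jointly Borel measurable with \<open>q\<close>, whereas a pair of Borel maps into a product that involves \<open>C\<^sup>2\<close>
    is not measurable for free.\<close>
  define V where "V \<omega> = ?A *v grad (c2_fun (q \<omega>)) 0" for \<omega>
  define W where "W \<omega> = ?S *v V \<omega>" for \<omega>
  define Y where "Y \<omega> = (q \<omega>, \<delta>tilde \<omega>)" for \<omega>
  define L where "L \<omega> = (q \<omega>, \<delta>tilde \<omega>, K, Some K, Some (V \<omega>), Some (W \<omega>))" for \<omega>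
  have Y: "Y \<in> borel_measurable N"
    using conv by (simp add: converges_in_law_def Y_def[abs_def])
  have cont_grad: "continuous_on UNIV (\<lambda>z :: 'p c2 \<times> (real^'p). grad (c2_fun (fst z)) 0)"
  proof -
    have "continuous_on UNIV (\<lambda>z :: 'p c2 \<times> (real^'p). (fst z, 0 :: real^'p))"
      by (intro continuous_intros)
    from continuous_on_compose2[OF continuous_on_grad_c2 this] show ?thesis by simp
  qed
  have cont_V: "continuous_on UNIV (\<lambda>z :: 'p c2 \<times> (real^'p). ?A *v grad (c2_fun (fst z)) 0)"
    by (intro continuous_intros cont_grad)
  have cont_L: "continuous_on UNIV (\<lambda>z :: 'p c2 \<times> (real^'p). (fst z, snd z, K, Some K, Some (?A *v grad (c2_fun (fst z)) 0),
      Some (?S *v (?A *v grad (c2_fun (fst z)) 0))))"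
    by (intro continuous_intros continuous_on_Some cont_grad)
  have L: "L \<in> borel_measurable N"
    using measurable_compose[OF Y borel_measurable_continuous_onI[OF cont_L]]
    by (simp add: L_def[abs_def] Y_def V_def W_def)
  have V: "V \<in> borel_measurable N"
    using measurable_compose[OF Y borel_measurable_continuous_onI[OF cont_V]]
    by (simp add: V_def[abs_def] Y_def)
  have mult: "(*v) C \<in> borel_measurable borel" for C :: "real^'p^'p"
    by (intro borel_measurable_continuous_onI continuous_intros)
  have W: "W \<in> borel_measurable N"
    unfolding W_def[abs_def] by (rule measurable_compose[OF V mult])

  have tK: "transpose K = K"
    using K by (simp add: pos_def_def)
  have AE_V: "AE \<omega> in N. V \<omega> = ?A *v Z (X \<omega>)"
    using q by eventually_elim (simp add: V_def quadratic_derivatives(1)[OF tK])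
  have AE_L: "AE \<omega> in N. newton_statistics (Y \<omega>) = L \<omega>"
    using q AE_V
  proof eventually_elim
    case (elim \<omega>)
    have "newton_point (Y \<omega>) = V \<omega>"
      using newton_point_quadratic[OF K] elim by (simp add: Y_def)
    moreover have "neg_hess (q \<omega>) x = K" for x
      using elim(1) by (intro quadratic_derivatives(2)[OF tK]) simp
    ultimately show ?case
      using newton_statistics_regular[of "Y \<omega>"] K
      by (simp add: newton_regular_def newton_domain_def L_def W_def Y_def)
  qed

  have law_X: "X \<in> measurable N \<nu>" "distr N \<nu> X = model_law \<nu> f 0"
    using loglik by (auto simp: log_likelihood_def)
  have Z: "Z \<in> borel_measurable \<nu>"
    using lamn by (simp add: lamn_model_def)
  have ZX: "(\<lambda>\<omega>. Z (X \<omega>)) \<in> borel_measurable N"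
    using law_X(1) Z by (rule measurable_compose)
  have "distr N borel (\<lambda>\<omega>. Z (X \<omega>)) = distr (distr N \<nu> X) borel Z"
    using law_X(1) Z by (simp add: distr_distr o_def)
  then have law_Z: "distr N borel (\<lambda>\<omega>. Z (X \<omega>)) = mv_normal 0 K"
    using law_X(2) lamn_constant_information_law[OF lamn] by simp
  have "distr N borel V = distr N borel (\<lambda>\<omega>. ?A *v Z (X \<omega>))"
    by (intro distr_cong_AE AE_V V measurable_compose[OF ZX mult]) simp_all
  also have "\<dots> = distr (mv_normal 0 K) borel ((*v) ?A)"
    unfolding law_Z[symmetric] using ZX mult by (simp add: distr_distr o_def)
  also have "\<dots> = mv_normal 0 ?A"
    by (rule distr_mv_normal_linear) (simp add: matrix_sqrt_matrix_inv[OF K])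
  finally have law_V: "distr N borel V = mv_normal 0 ?A" .
  have "distr N borel W = distr (distr N borel V) borel ((*v) ?S)"
    unfolding W_def[abs_def] using V mult by (simp add: distr_distr o_def)
  also have "\<dots> = mv_normal 0 (mat 1)"
    unfolding law_V
    by (rule distr_mv_normal_linear)
      (simp add: matrix_sqrt_matrix_inv[OF K] matrix_sqrt_eqI[OF pos_def_mat_1])
  finally have law_W: "distr N borel W = mv_normal 0 (mat 1)" .

  obtain \<phi> :: "'p c2 \<times> (real^'p) \<Rightarrow> real" where
    \<phi>: "continuous_on UNIV \<phi>" "\<And>z. 0 \<le> \<phi> z" "\<And>z. \<phi> z \<le> 1" "{z. \<phi> z \<noteq> 0} \<subseteq> newton_regular"
    and \<phi>1: "\<And>z. neg_hess (fst z) (snd z) = K \<Longrightarrow> neg_hess (fst z) (newton_point z) = K \<Longrightarrow> \<phi> z = 1"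
  proof (rule newton_cutoff_exists[OF K], goal_cases)
    case (1 \<phi>)
    from 1(2-6) show ?case by (rule 1(1))
  qed
  have "AE \<omega> in N. \<phi> (Y \<omega>) = 1"
    using q
  proof eventually_elim
    case (elim \<omega>)
    have "neg_hess (q \<omega>) x = K" for x
      using elim by (intro quadratic_derivatives(2)[OF tK]) simp
    then show ?case by (intro \<phi>1) (simp_all add: Y_def)
  qed
  then have "converges_in_law M (\<lambda>n \<omega>. newton_statistics (q\<^sub>n n \<omega>, \<delta>tilde\<^sub>n n \<omega>)) N (\<lambda>\<omega>. newton_statistics (Y \<omega>))"
    unfolding Y_def
    by (rule converges_in_law_mapping[OF conv \<phi>(1-3) _ borel_measurable_newton_statistics
        continuous_on_subset[OF continuous_on_newton_statistics \<phi>(4)]])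
  then have "converges_in_law M (\<lambda>n \<omega>. newton_statistics (q\<^sub>n n \<omega>, \<delta>tilde\<^sub>n n \<omega>)) N L"
    by (rule converges_in_law_AE_cong[OF _ L AE_L])
  then have joint: "converges_in_law M
      (\<lambda>n \<omega>. (q\<^sub>n n \<omega>, \<delta>tilde\<^sub>n n \<omega>, Ktilde\<^sub>n n \<omega>, Khat\<^sub>n n \<omega>, \<delta>hat\<^sub>n n \<omega>, What\<^sub>n n \<omega>)) N
      (\<lambda>\<omega>. (q \<omega>, \<delta>tilde \<omega>, K, Some K, Some (V \<omega>), Some (W \<omega>)))"
    by (simp add: newton_statistics_def Let_def L_def[abs_def] Ktilde\<^sub>n_def Khat\<^sub>n_def \<delta>hat\<^sub>n_def What\<^sub>n_def)

  have "converges_in_law M Ktilde\<^sub>n N (\<lambda>_. K)"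
    using converges_in_law_compose[OF joint, of "\<lambda>z. fst (snd (snd z))"] by (simp add: continuous_intros)
  moreover have "converges_in_law M Khat\<^sub>n N (\<lambda>_. Some K)"
    using converges_in_law_compose[OF joint, of "\<lambda>z. fst (snd (snd (snd z)))"] by (simp add: continuous_intros)
  moreover have "converges_in_law M \<delta>hat\<^sub>n N (\<lambda>\<omega>. Some (V \<omega>))"
    using converges_in_law_compose[OF joint, of "\<lambda>z. fst (snd (snd (snd (snd z))))"] by (simp add: continuous_intros)
  then have "converges_in_law M \<delta>hat\<^sub>n (mv_normal 0 ?A) Some"
    unfolding law_V[symmetric] by (rule converges_in_law_distr[OF _ V]) (intro continuous_on_Some continuous_on_id)
  moreover have "converges_in_law M What\<^sub>n N (\<lambda>\<omega>. Some (W \<omega>))"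
    using converges_in_law_compose[OF joint, of "\<lambda>z. snd (snd (snd (snd (snd z))))"] by (simp add: continuous_intros)
  then have "converges_in_law M What\<^sub>n (mv_normal 0 (mat 1)) Some"
    unfolding law_W[symmetric] by (rule converges_in_law_distr[OF _ W]) (intro continuous_on_Some continuous_on_id)
  ultimately show ?thesis
    using joint V W law_V law_W by blast
qed

end
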